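(* Let $W$ be a vector space and let $a(x),b(x)\in\mathcal{E}^o(W)$. Assume $$[a(x_1),b(x_2)]=\sum_{j=0}^{r}A_j(x_2)\frac{1}{j!}\left(\frac{\partial}{\partial x_2}\right)^{j}x_1^{-1}\delta\left(\frac{x_2}{x_1}\right)+\sum_{i=1}^{k}\sum_{j=0}^{s}B_{ij}(x_2)\frac{1}{j!}\left(\frac{\partial}{\partial x_2}\right)^{j}x_1^{-1}\delta\left(\frac{g_i(x_2)}{x_1}\right),$$ where $A_j(x),B_{ij}(x)\in\mathcal{E}^o(W)$ and $g_i(x)\in G$ with $g_i(x)\ne x$ for $1\le i\le k$. Then $$a(x)_jb(x)=-A_j(x)\ \text{ for } 0\le j\le r,\qquad a(x)_jb(x)=0\ \text{ for } j>r.$$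
   Context: All vector spaces are over $\mathbb{C}$. $G=\{\alpha x+\beta\mid \alpha\in\mathbb{C}^{\times},\beta\in\mathbb{C}\}$, a group under composition. For $g(x)=\alpha x+\beta\in G$ and $n\in\mathbb{Z}$, $g(x)^n=\sum_{i\ge0}\binom{n}{i}\alpha^{n-i}\beta^ix^{n-i}\in\mathbb{C}((x^{-1}))$, and $\delta\left(\frac{g(x_2)}{x_1}\right)=\sum_{n\in\mathbb{Z}}x_1^{-n}g(x_2)^n$. $\mathcal{E}^{o}(W)=\mathrm{Hom}(W,W((x^{-1})))\subset(\mathrm{End}\,W)[[x,x^{-1}]]$. $W((x_1^{-1},x_2^{-1}))$ is the space of series $\sum w_{m,n}x_1^mx_2^n$ with $m,n$ bounded above. Products $a(x)_nb(x)$: let $a(x),b(x)\in\mathcal{E}^o(W)$ be such that there is a nonzero polynomial $p(x_1,x_2)$ with $p(x_1,x_2)a(x_1)b(x_2)\in\mathrm{Hom}(W,W((x_1^{-1},x_2^{-1})))$ (this holds in particular if $p(x_1,x_2)[a(x_1),b(x_2)]=0$). Then $a(x)_nb(x)\in\mathcal{E}^o(W)$, $n\in\mathbb{Z}$, are defined by $$Y_{\mathcal{E}^o}(a(x),x_0)b(x)=\sum_{n\in\mathbb{Z}}a(x)_nb(x)\,x_0^{-n-1}=\iota_{x^{-1},x_0}\left(\frac{1}{p(x+x_0,x)}\right)\left(p(x_1,x)a(x_1)b(x)\right)|_{x_1=x+x_0},$$ where $\iota_{x^{-1},x_0}:\mathbb{C}(x,x_0)\to\mathbb{C}((x^{-1}))((x_0))$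 is the field embedding extending the embedding of $\mathbb{C}[x,x_0]$, and the substitution $x_1=x+x_0$ is expanded in nonnegative powers of $x_0$. This does not depend on the choice of $p$. *)

theory Defs
  imports Complex_Main "HOL-Computational_Algebra.Computational_Algebra"
begin

unbundle fps_syntax

text \<open>
  Throughout, the variable of type \<open>fls\<close> stands for \<open>x\<^sup>-\<^sup>1\<close>: \<open>W((x\<^sup>-\<^sup>1))\<close> is the type \<open>'w fls\<close>,
  and the coefficient of \<open>x ^ n\<close> in \<open>v\<close> is the one of index \<open>- n\<close>. The only exception is the outer
  layer of a type \<open>_ fls fls\<close>, whose variable is \<open>x\<^sub>0\<close> itself; so \<open>complex fls fls\<close> is
  \<open>\<complex>((x\<^sup>-\<^sup>1))((x\<^sub>0))\<close> and \<open>'w fls fls\<close> is \<open>W((x\<^sup>-\<^sup>1))((x\<^sub>0))\<close>.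
\<close>

definition xcoeff :: "'a::zero fls \<Rightarrow> int \<Rightarrow> 'a" where
  "xcoeff v n = v $$ (- n)"


section \<open>Products of a scalar series and a vector series\<close>

text \<open>
  The Cauchy product along a pairing \<open>act\<close>. It is used with \<open>act = scale\<close> for the action of
  \<open>\<complex>((x\<^sup>-\<^sup>1))\<close> on \<open>W((x\<^sup>-\<^sup>1))\<close>, and with \<open>act = fls_act scale\<close> for the action of
  \<open>\<complex>((x\<^sup>-\<^sup>1))((x\<^sub>0))\<close> on \<open>W((x\<^sup>-\<^sup>1))((x\<^sub>0))\<close>.
\<close>

definition fls_act ::
    "('a::zero \<Rightarrow> 'b::zero \<Rightarrow> 'c::comm_monoid_add) \<Rightarrow> 'a fls \<Rightarrow> 'b fls \<Rightarrow> 'c fls" where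
  "fls_act act f v =
     Abs_fls (\<lambda>n. \<Sum>i\<in>{fls_subdegree f..n - fls_subdegree v}. act (f $$ i) (v $$ (n - i)))"

lemma fls_act_nth:
  "fls_act act f v $$ n =
     (\<Sum>i\<in>{fls_subdegree f..n - fls_subdegree v}. act (f $$ i) (v $$ (n - i)))"
  unfolding fls_act_def
  by (rule nth_Abs_fls_lower_bound[of "fls_subdegree f + fls_subdegree v"]) auto

lemma fls_act_const_nth:
  assumes "vector_space scale"
  shows "fls_act scale (fls_const c) v $$ n = scale c (v $$ n)"
proof -
  interpret vector_space scale by fact
  have "fls_act scale (fls_const c) v $$ n =
      (\<Sum>i\<in>{0..n - fls_subdegree v}. if i = 0 then scale c (v $$ n) else 0)"
    unfolding fls_act_nth by (intro sum.cong) auto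
  also have "\<dots> = scale c (v $$ n)"
    by (simp add: sum.delta)
  finally show ?thesis .
qed


section \<open>The space \<open>\<E>\<^sup>o(W) = Hom(W, W((x\<^sup>-\<^sup>1)))\<close>\<close>

definition Eo :: "(complex \<Rightarrow> 'w \<Rightarrow> 'w::ab_group_add) \<Rightarrow> ('w \<Rightarrow> 'w fls) set" where
  "Eo scale = {a. Vector_Spaces.linear scale (\<lambda>c. fls_act scale (fls_const c)) a}"

lemma vector_space_fls:
  assumes "vector_space scale"
  shows "vector_space (\<lambda>c. fls_act scale (fls_const c))"
proof -
  interpret vector_space scale by fact
  show ?thesis
    by unfold_locales
      (auto intro!: fls_eqI
        simp: fls_act_const_nth[OF assms] scale_right_distrib scale_left_distrib
        simp flip: fls_const_1)
qed

lemma Eo_iff: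
  assumes "vector_space scale"
  shows "a \<in> Eo scale \<longleftrightarrow> (\<forall>n. Vector_Spaces.linear scale scale (\<lambda>w. xcoeff (a w) n))"
proof -
  have "(\<forall>n. P (- n)) \<longleftrightarrow> (\<forall>n. P n)" for P :: "int \<Rightarrow> bool"
    by (metis minus_minus)
  note this[of "\<lambda>n. Vector_Spaces.linear scale scale (\<lambda>w. a w $$ n)"]
  moreover have "Vector_Spaces.linear scale (\<lambda>c. fls_act scale (fls_const c)) a \<longleftrightarrow>
      (\<forall>n. Vector_Spaces.linear scale scale (\<lambda>w. a w $$ n))"
    using assms vector_space_fls[OF assms]
    by (auto simp: Vector_Spaces.linear_iff fls_eq_iff fls_act_const_nth[OF assms])
  ultimately show ?thesis
    by (simp add: Eo_def xcoeff_def)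
qed


section \<open>Series in \<open>x\<^sub>1\<close> and \<open>x\<^sub>2\<close>\<close>

text \<open>
  An element of \<open>(End W)[[x\<^sub>1, x\<^sub>1\<^sup>-\<^sup>1, x\<^sub>2, x\<^sub>2\<^sup>-\<^sup>1]]\<close> is given by \<open>F m n w\<close>, the value at \<open>w\<close> of the
  coefficient of \<open>x\<^sub>1 ^ m * x\<^sub>2 ^ n\<close>.
\<close>

definition op_prod ::
    "('w \<Rightarrow> 'w fls) \<Rightarrow> ('w \<Rightarrow> 'w::zero fls) \<Rightarrow> int \<Rightarrow> int \<Rightarrow> 'w \<Rightarrow> 'w" where
  "op_prod a b m n w = xcoeff (a (xcoeff (b w) n)) m"

definition commutator ::
    "('w \<Rightarrow> 'w fls) \<Rightarrow> ('w \<Rightarrow> 'w::ab_group_add fls) \<Rightarrow> int \<Rightarrow> int \<Rightarrow> 'w \<Rightarrow> 'w" where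
  "commutator a b m n w = op_prod a b m n w - op_prod b a n m w"


section \<open>The group \<open>G\<close> and delta functions\<close>

definition affine_G :: "complex poly set" where
  "affine_G = {[:\<beta>, \<alpha>:] | \<alpha> \<beta>. \<alpha> \<noteq> 0}"

text \<open>
  The expansion \<open>g(x) ^ n = (\<Sum>i. (n choose i) \<alpha> ^ (n - i) \<beta> ^ i x ^ (n - i))\<close> for
  \<open>g(x) = \<alpha> x + \<beta>\<close>; index \<open>l\<close> is the exponent \<open>n - i = - l\<close> of \<open>x\<close>, that is, \<open>i = n + l\<close>.
\<close>

definition affine_powi :: "complex poly \<Rightarrow> int \<Rightarrow> complex fls" where
  "affine_powi g n = Abs_fls (\<lambda>l. if 0 \<le> n + l
     then (of_int n gchoose nat (n + l)) * coeff g 1 powi (- l) * coeff g 0 ^ nat (n + l)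
     else 0)"

lemma affine_powi_nth:
  "affine_powi g n $$ l = (if 0 \<le> n + l
     then (of_int n gchoose nat (n + l)) * coeff g 1 powi (- l) * coeff g 0 ^ nat (n + l)
     else 0)"
  unfolding affine_powi_def by (rule nth_Abs_fls_lower_bound[of "- n"]) auto

text \<open>\<open>d/dx = - x\<^sup>-\<^sup>2 d/d(x\<^sup>-\<^sup>1)\<close>\<close>

definition xderiv :: "complex fls \<Rightarrow> complex fls" where
  "xderiv f = - (fls_X ^ 2 * fls_deriv f)"

lemma xcoeff_xderiv: "xcoeff (xderiv f) n = of_int (n + 1) * xcoeff f (n + 1)"
  by (simp add: xderiv_def xcoeff_def fls_X_power_times_conv_shift algebra_simps)

text \<open>
  The coefficient of \<open>x\<^sub>1 ^ m\<close> in \<open>(1/j!) (\<partial>/\<partial>x\<^sub>2) ^ j x\<^sub>1\<^sup>-\<^sup>1 \<delta>(g(x\<^sub>2)/x\<^sub>1)\<close>, where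
  \<open>x\<^sub>1\<^sup>-\<^sup>1 \<delta>(g(x\<^sub>2)/x\<^sub>1) = (\<Sum>n. x\<^sub>1 ^ (- n - 1) * g(x\<^sub>2) ^ n)\<close>.
\<close>

definition delta_deriv :: "nat \<Rightarrow> complex poly \<Rightarrow> int \<Rightarrow> complex fls" where
  "delta_deriv j g m = fls_const (1 / fact j) * (xderiv ^^ j) (affine_powi g (- m - 1))"


section \<open>The embedding \<open>\<iota>\<close> of \<open>\<complex>(x, x\<^sub>0)\<close> into \<open>\<complex>((x\<^sup>-\<^sup>1))((x\<^sub>0))\<close>\<close>

text \<open>
  In \<open>complex poly poly\<close> the outer variable is the first one for \<open>\<complex>[x\<^sub>1, x\<^sub>2]\<close>, but it is \<open>x\<^sub>0\<close>
  for \<open>\<complex>[x, x\<^sub>0]\<close>, as in \<open>\<complex>((x\<^sup>-\<^sup>1))((x\<^sub>0))\<close>.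
\<close>

definition emb_x :: "complex poly \<Rightarrow> complex fls" where
  "emb_x q = poly (map_poly fls_const q) fls_X_inv"

definition emb_x_x0 :: "complex poly poly \<Rightarrow> complex fls fls" where
  "emb_x_x0 P = poly (map_poly (\<lambda>q. fls_const (emb_x q)) P) fls_X"

definition iota :: "complex poly poly fract \<Rightarrow> complex fls fls" where
  "iota q = (THE z. \<exists>P Q. Q \<noteq> 0 \<and> q = Fract P Q \<and> z = emb_x_x0 P / emb_x_x0 Q)"

lemma poly_map_poly_hom:
  fixes f :: "'a::comm_ring_1 \<Rightarrow> 'b::comm_ring_1"
  assumes "f 0 = 0" "\<And>x y. f (x + y) = f x + f y" "\<And>x y. f (x * y) = f x * f y"
  shows "poly (map_poly f (p + q)) z = poly (map_poly f p) z + poly (map_poly f q) z"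
    and "poly (map_poly f (p * q)) z = poly (map_poly f p) z * poly (map_poly f q) z"
proof -
  have sum: "f (sum h A) = (\<Sum>i\<in>A. f (h i))" for h :: "nat \<Rightarrow> 'a" and A
    by (induction A rule: infinite_finite_induct) (simp_all add: assms)
  have "map_poly f (p + q) = map_poly f p + map_poly f q"
    by (intro poly_eqI) (simp add: coeff_map_poly assms)
  then show "poly (map_poly f (p + q)) z = poly (map_poly f p) z + poly (map_poly f q) z"
    by simp
  have "map_poly f (p * q) = map_poly f p * map_poly f q"
    by (intro poly_eqI) (simp add: coeff_map_poly assms coeff_mult sum)
  then show "poly (map_poly f (p * q)) z = poly (map_poly f p) z * poly (map_poly f q) z"
    by simp
qed

lemma emb_x_hom:
  "emb_x 0 = 0" "emb_x 1 = 1" "emb_x (p + q) = emb_x p + emb_x q" "emb_x (p * q) = emb_x p * emb_x q"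
  unfolding emb_x_def
  by (simp_all add: poly_map_poly_hom[of fls_const] fls_plus_const fls_const_mult_const)

lemma xcoeff_emb_x: "xcoeff (emb_x q) (int n) = coeff q n"
proof -
  have "emb_x q = (\<Sum>i\<le>degree q. fls_const (coeff q i) * fls_X_inv ^ i)"
    unfolding emb_x_def by (simp add: poly_altdef coeff_map_poly degree_map_poly)
  also have "\<dots> $$ (- int n) = (\<Sum>i\<le>degree q. if i = n then coeff q n else 0)"
    unfolding fls_nth_sum by (intro sum.cong) auto
  finally show ?thesis
    by (auto simp: xcoeff_def coeff_eq_0)
qed

lemma emb_x_x0_hom:
  "emb_x_x0 0 = 0" "emb_x_x0 1 = 1"
  "emb_x_x0 (P + Q) = emb_x_x0 P + emb_x_x0 Q" "emb_x_x0 (P * Q) = emb_x_x0 P * emb_x_x0 Q"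
  unfolding emb_x_x0_def
  by (simp_all add: poly_map_poly_hom[of "\<lambda>q. fls_const (emb_x q)"] emb_x_hom
      fls_plus_const fls_const_mult_const)

lemma emb_x_x0_nth: "emb_x_x0 P $$ int n = emb_x (coeff P n)"
proof -
  have "fls_const (emb_x q) = 0 \<longleftrightarrow> q = 0" for q
    by (metis emb_x_hom(1) fls_const_nonzero fls_const_0 poly_eqI xcoeff_emb_x coeff_0)
  then have "emb_x_x0 P = (\<Sum>i\<le>degree P. fls_const (emb_x (coeff P i)) * fls_X ^ i)"
    unfolding emb_x_x0_def by (simp add: poly_altdef coeff_map_poly degree_map_poly emb_x_hom)
  also have "\<dots> $$ int n = (\<Sum>i\<le>degree P. if i = n then emb_x (coeff P n) else 0)"
    unfolding fls_nth_sum by (intro sum.cong) auto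
  finally show ?thesis
    by (auto simp: coeff_eq_0 emb_x_hom)
qed

lemma emb_x_x0_eq_0_iff: "emb_x_x0 P = 0 \<longleftrightarrow> P = 0"
proof
  assume "emb_x_x0 P = 0"
  then have "emb_x (coeff P n) = 0" for n
    by (metis emb_x_x0_nth fls_zero_nth)
  then have "coeff (coeff P n) m = 0" for n m
    by (metis xcoeff_emb_x xcoeff_def fls_zero_nth)
  then show "P = 0"
    by (intro poly_eqI) simp
qed (simp add: emb_x_x0_hom)

lemma iota_Fract:
  assumes "Q \<noteq> 0"
  shows "iota (Fract P Q) = emb_x_x0 P / emb_x_x0 Q"
  unfolding iota_def
proof (rule the_equality)
  fix z
  assume "\<exists>P' Q'. Q' \<noteq> 0 \<and> Fract P Q = Fract P' Q' \<and> z = emb_x_x0 P' / emb_x_x0 Q'"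
  then obtain P' Q' where *: "Q' \<noteq> 0" "Fract P Q = Fract P' Q'" "z = emb_x_x0 P' / emb_x_x0 Q'"
    by blast
  then have "P * Q' = P' * Q"
    using assms by (simp add: eq_fract)
  then have "emb_x_x0 P * emb_x_x0 Q' = emb_x_x0 P' * emb_x_x0 Q"
    by (metis emb_x_x0_hom(4))
  then show "z = emb_x_x0 P / emb_x_x0 Q"
    using * assms by (simp add: emb_x_x0_eq_0_iff frac_eq_eq)
qed (use assms in blast)


section \<open>The products \<open>a(x)\<^sub>n b(x)\<close>\<close>

text \<open>\<open>p(x\<^sub>1, x\<^sub>2) F(x\<^sub>1, x\<^sub>2)\<close>\<close>

definition mult_poly2 ::
    "(complex \<Rightarrow> 'w \<Rightarrow> 'w::ab_group_add) \<Rightarrow> complex poly poly \<Rightarrow>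
     (int \<Rightarrow> int \<Rightarrow> 'w \<Rightarrow> 'w) \<Rightarrow> int \<Rightarrow> int \<Rightarrow> 'w \<Rightarrow> 'w" where
  "mult_poly2 scale p F m n w =
     (\<Sum>i\<le>degree p. \<Sum>j\<le>degree (coeff p i).
        scale (coeff (coeff p i) j) (F (m - int i) (n - int j) w))"

text \<open>
  \<open>Hom(W, W((x\<^sub>1\<^sup>-\<^sup>1, x\<^sub>2\<^sup>-\<^sup>1)))\<close> as a subset of \<open>(End W)[[x\<^sub>1, x\<^sub>1\<^sup>-\<^sup>1, x\<^sub>2, x\<^sub>2\<^sup>-\<^sup>1]]\<close>
\<close>

definition Hom_trunc2 ::
    "(complex \<Rightarrow> 'w \<Rightarrow> 'w::ab_group_add) \<Rightarrow> (int \<Rightarrow> int \<Rightarrow> 'w \<Rightarrow> 'w) set" where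
  "Hom_trunc2 scale = {F. (\<forall>m n. Vector_Spaces.linear scale scale (F m n)) \<and>
     (\<forall>w. \<exists>M N. \<forall>m n. F m n w \<noteq> 0 \<longrightarrow> m \<le> M \<and> n \<le> N)}"

definition admissible ::
    "(complex \<Rightarrow> 'w \<Rightarrow> 'w::ab_group_add) \<Rightarrow> ('w \<Rightarrow> 'w fls) \<Rightarrow> ('w \<Rightarrow> 'w fls) \<Rightarrow>
     complex poly poly \<Rightarrow> bool" where
  "admissible scale a b p \<longleftrightarrow> p \<noteq> 0 \<and> mult_poly2 scale p (op_prod a b) \<in> Hom_trunc2 scale"

text \<open>
  \<open>F(x + x\<^sub>0, x) w\<close>: the monomial \<open>x\<^sub>1 ^ m * x\<^sub>2 ^ n\<close> contributes \<open>(m choose i) x ^ (m - i + n)\<close> to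
  the coefficient of \<open>x\<^sub>0 ^ i\<close>, so that \<open>n = i - m - l\<close> at index \<open>l = - (m - i + n)\<close>. For \<open>F\<close> in
  \<open>Hom(W, W((x\<^sub>1\<^sup>-\<^sup>1, x\<^sub>2\<^sup>-\<^sup>1)))\<close> the sum is finite, and empty for all small \<open>l\<close>.
\<close>

definition subst_x_plus_x0 ::
    "(complex \<Rightarrow> 'w \<Rightarrow> 'w::ab_group_add) \<Rightarrow> (int \<Rightarrow> int \<Rightarrow> 'w \<Rightarrow> 'w) \<Rightarrow> 'w \<Rightarrow> 'w fls fls" where
  "subst_x_plus_x0 scale F w = fps_to_fls (Abs_fps (\<lambda>i. Abs_fls (\<lambda>l.
     \<Sum>m | F m (int i - m - l) w \<noteq> 0. scale (of_int m gchoose i) (F m (int i - m - l) w))))"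

text \<open>\<open>Y\<^bsub>\<E>\<^sup>o\<^esub>(a(x), x\<^sub>0) b(x) w\<close> computed with the polynomial \<open>p\<close>\<close>

definition Y_Eo_with ::
    "(complex \<Rightarrow> 'w \<Rightarrow> 'w::ab_group_add) \<Rightarrow> complex poly poly \<Rightarrow>
     ('w \<Rightarrow> 'w fls) \<Rightarrow> ('w \<Rightarrow> 'w fls) \<Rightarrow> 'w \<Rightarrow> 'w fls fls" where
  "Y_Eo_with scale p a b w =
     fls_act (fls_act scale)
       (iota (Fract 1 (pcompose p [:[:0, 1:], 1:])))
       (subst_x_plus_x0 scale (mult_poly2 scale p (op_prod a b)) w)"

text \<open>
  The product does not depend on the choice of the admissible polynomial. It is meaningful only if
  there is one.
\<close>

definition nth_prod ::
    "(complex \<Rightarrow> 'w \<Rightarrow> 'w::ab_group_add) \<Rightarrow> ('w \<Rightarrow> 'w fls) \<Rightarrow> int \<Rightarrow> ('w \<Rightarrow> 'w fls) \<Rightarrow> 'w \<Rightarrow> 'w fls"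
  where
  "nth_prod scale a n b w = Y_Eo_with scale (SOME p. admissible scale a b p) a b w $$ (- n - 1)"

end

theory Submission
  imports Defs
begin

text \<open>
  Write \<open>c = [a(x\<^sub>1), b(x\<^sub>2)]\<close> and \<open>q = (\<Prod>i. (x\<^sub>1 - g\<^sub>i(x\<^sub>2)) ^ (s + 1))\<close>. Since \<open>x\<^sub>1 - g(x\<^sub>2)\<close> lowers the
  order of a derivative of \<open>x\<^sub>1\<^sup>-\<^sup>1 \<delta>(g(x\<^sub>2)/x\<^sub>1)\<close> by one, \<open>q\<close> removes the terms \<open>B\<^sub>i\<^sub>j\<close> from \<open>c\<close>, and
  \<open>p = (x\<^sub>1 - x\<^sub>2) ^ (r + 1) q\<close> removes all of \<open>c\<close>. Hence \<open>F = p a(x\<^sub>1) b(x\<^sub>2) = p b(x\<^sub>2) a(x\<^sub>1)\<close> is truncated in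
  both variables, that is, \<open>p\<close> is admissible. Polynomials commute with the substitution \<open>x\<^sub>1 = x + x\<^sub>0\<close>, so
  \<open>p(x + x\<^sub>0, x) Y = F(x + x\<^sub>0, x)\<close> for the series \<open>Y\<close> computed with any admissible polynomial
  (\<open>Y_Eo_with_cross_mult\<close>).

  It remains to find \<open>F(x + x\<^sub>0, x)\<close> modulo \<open>x\<^sub>0 ^ (r + 1)\<close>. Its coefficient at \<open>x\<^sub>0 ^ i\<close> is
  \<open>1/i! (\<partial>/\<partial>x\<^sub>1) ^ i F\<close> at \<open>x\<^sub>1 = x\<^sub>2 = x\<close>, which is the residue in \<open>x\<^sub>1\<close> of the difference of the two expansions of
  \<open>F / (x\<^sub>1 - x\<^sub>2) ^ (i + 1)\<close>. For \<open>i \<le> r\<close> the expansion for large \<open>x\<^sub>1\<close> is \<open>(x\<^sub>1 - x\<^sub>2) ^ (r - i) q b(x\<^sub>2) a(x\<^sub>1)\<close> and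
  the one for large \<open>x\<^sub>2\<close> is \<open>(x\<^sub>1 - x\<^sub>2) ^ (r - i) q a(x\<^sub>1) b(x\<^sub>2)\<close>. So the coefficient is minus the residue of
  \<open>(x\<^sub>1 - x\<^sub>2) ^ (r - i) q c\<close> (\<open>subst_nth_eq_residue_diff\<close>, where the two expansions are replaced by a
  summation by parts over the negative and over the nonnegative powers of \<open>x\<^sub>1\<close>). In that residue, pairing a
  polynomial with the \<open>j\<close>-th derivative of the delta function at \<open>x\<^sub>1 = x\<^sub>2\<close> gives its \<open>j\<close>-th Taylor coefficient
  (\<open>polyact_delta_term_residue\<close>).

  Together, \<open>p(x + x\<^sub>0, x) (Y + (\<Sum>j\<le>r. A\<^sub>j(x) x\<^sub>0 ^ (- j - 1)))\<close> has no powers of \<open>x\<^sub>0\<close> below \<open>r + 1\<close>. As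
  \<open>p(x + x\<^sub>0, x) = x\<^sub>0 ^ (r + 1) q(x + x\<^sub>0, x)\<close>, and \<open>q(x, x) \<noteq> 0\<close> because no \<open>g\<^sub>i\<close> is the identity,
  \<open>p(x + x\<^sub>0, x)\<close> has order exactly \<open>r + 1\<close> in \<open>x\<^sub>0\<close>. Dividing by it shows that the sum in the bracket has no
  negative powers of \<open>x\<^sub>0\<close>, and the coefficients of \<open>Y\<close> at these powers are the products in question.
\<close>

section \<open>Modules of Laurent series\<close>

context module
begin

text \<open>
  The index set in the definition of \<open>fls_act\<close> depends on the subdegrees, which are badly behaved under sums. Any
  finite set that contains the support can be used instead, so that several products can be summed over one set.
\<close>

lemma fls_act_nth_eq_sum:
  assumes "finite I" "\<And>i. f $$ i \<noteq> 0 \<Longrightarrow> v $$ (n - i) \<noteq> 0 \<Longrightarrow> i \<in> I"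
  shows "fls_act scale f v $$ n = (\<Sum>i\<in>I. scale (f $$ i) (v $$ (n - i)))"
proof -
  let ?S = "{i\<in>I. scale (f $$ i) (v $$ (n - i)) \<noteq> 0}"
  have *: "f $$ i \<noteq> 0 \<and> v $$ (n - i) \<noteq> 0" if "scale (f $$ i) (v $$ (n - i)) \<noteq> 0" for i
    using that by auto
  have "fls_act scale f v $$ n = (\<Sum>i\<in>?S. scale (f $$ i) (v $$ (n - i)))"
    unfolding fls_act_nth
  proof (rule sum.mono_neutral_right)
    show "?S \<subseteq> {fls_subdegree f..n - fls_subdegree v}"
    proof
      fix i assume "i \<in> ?S"
      then have "f $$ i \<noteq> 0" "v $$ (n - i) \<noteq> 0"
        using * by auto
      then have "fls_subdegree f \<le> i" "fls_subdegree v \<le> n - i"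
        by (meson fls_subdegree_leI)+
      then show "i \<in> {fls_subdegree f..n - fls_subdegree v}"
        by auto
    qed
  qed (use * assms(2) in auto)
  also have "\<dots> = (\<Sum>i\<in>I. scale (f $$ i) (v $$ (n - i)))"
    using assms(1) by (intro sum.mono_neutral_left) auto
  finally show ?thesis .
qed

lemma fls_act_nth_eq_sum_interval:
  assumes "\<And>i. i < p \<Longrightarrow> f $$ i = 0" "\<And>i. i < q \<Longrightarrow> v $$ i = 0" "n - q \<le> u"
  shows "fls_act scale f v $$ n = (\<Sum>i\<in>{p..u}. scale (f $$ i) (v $$ (n - i)))"
proof (rule fls_act_nth_eq_sum)
  fix i assume "f $$ i \<noteq> 0" "v $$ (n - i) \<noteq> 0"
  then have "\<not> i < p" "\<not> n - i < q"
    using assms by blast+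
  with assms(3) show "i \<in> {p..u}" by auto
qed simp

text \<open>
  Stated for modules rather than vector spaces, because this can be iterated: it makes \<open>W((x\<^sup>-\<^sup>1))((x\<^sub>0))\<close> a
  module over \<open>\<complex>((x\<^sup>-\<^sup>1))((x\<^sub>0))\<close> in two steps.
\<close>

lemma module_fls_act: "module (fls_act scale)"
proof
  fix f g :: "'a fls" and v u :: "'b fls"
  show "fls_act scale f (v + u) = fls_act scale f v + fls_act scale f u"
  proof (rule fls_eqI)
    fix n
    define q where "q = min (fls_subdegree v) (fls_subdegree u)"
    have "fls_act scale f y $$ n = (\<Sum>i\<in>{fls_subdegree f..n - q}. scale (f $$ i) (y $$ (n - i)))"
      if "y \<in> {v, u, v + u}" for y
      using that by (intro fls_act_nth_eq_sum_interval[where q = q]) (auto simp: q_def)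
    then show "fls_act scale f (v + u) $$ n = (fls_act scale f v + fls_act scale f u) $$ n"
      by (simp add: scale_right_distrib sum.distrib)
  qed
  show "fls_act scale (f + g) v = fls_act scale f v + fls_act scale g v"
  proof (rule fls_eqI)
    fix n
    define p where "p = min (fls_subdegree f) (fls_subdegree g)"
    have "fls_act scale y v $$ n = (\<Sum>i\<in>{p..n - fls_subdegree v}. scale (y $$ i) (v $$ (n - i)))"
      if "y \<in> {f, g, f + g}" for y
      using that by (intro fls_act_nth_eq_sum_interval) (auto simp: p_def)
    then show "fls_act scale (f + g) v $$ n = (fls_act scale f v + fls_act scale g v) $$ n"
      by (simp add: scale_left_distrib sum.distrib)
  qed
  show "fls_act scale f (fls_act scale g v) = fls_act scale (f * g) v"
  proof (rule fls_eqI)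
    fix n
    define p q s where "p = fls_subdegree f" and "q = fls_subdegree g" and "s = fls_subdegree v"
    have z: "f $$ i = 0" if "i < p" for i using that by (simp add: p_def)
    have z': "g $$ i = 0" if "i < q" for i using that by (simp add: q_def)
    have z'': "v $$ i = 0" if "i < s" for i using that by (simp add: s_def)
    have fg: "(f * g) $$ k = (\<Sum>i\<in>{p..k - q}. f $$ i * g $$ (k - i))" for k
      unfolding p_def q_def by (rule fls_times_nth(2))
    have gv: "fls_act scale g v $$ k = (\<Sum>j\<in>{q..k - s}. scale (g $$ j) (v $$ (k - j)))" for k
      using z' z'' by (intro fls_act_nth_eq_sum_interval) auto
    have "fls_act scale f (fls_act scale g v) $$ n =
        (\<Sum>i\<in>{p..n - q - s}. scale (f $$ i) (fls_act scale g v $$ (n - i)))"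
      using z by (intro fls_act_nth_eq_sum_interval[where q = "q + s"]) (auto simp: gv)
    also have "\<dots> = (\<Sum>i\<in>{p..n - q - s}. \<Sum>k\<in>{p + q..n - s}.
        scale (f $$ i * g $$ (k - i)) (v $$ (n - k)))"
    proof (rule sum.cong)
      fix i assume i: "i \<in> {p..n - q - s}"
      have "scale (f $$ i) (fls_act scale g v $$ (n - i)) =
          (\<Sum>j\<in>{q..n - i - s}. scale (f $$ i * g $$ j) (v $$ (n - i - j)))"
        by (simp add: gv scale_sum_right)
      also have "\<dots> = (\<Sum>k\<in>{i + q..n - s}. scale (f $$ i * g $$ (k - i)) (v $$ (n - k)))"
        by (rule sum.reindex_bij_witness[of _ "\<lambda>k. k - i" "\<lambda>j. j + i"]) (auto simp: algebra_simps)
      also have "\<dots> = (\<Sum>k\<in>{p + q..n - s}. scale (f $$ i * g $$ (k - i)) (v $$ (n - k)))"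
        using i by (intro sum.mono_neutral_left) (auto simp: z')
      finally show "scale (f $$ i) (fls_act scale g v $$ (n - i)) = \<dots>" .
    qed simp
    also have "\<dots> = (\<Sum>k\<in>{p + q..n - s}. \<Sum>i\<in>{p..n - q - s}.
        scale (f $$ i * g $$ (k - i)) (v $$ (n - k)))"
      by (rule sum.swap)
    also have "\<dots> = (\<Sum>k\<in>{p + q..n - s}. scale ((f * g) $$ k) (v $$ (n - k)))"
    proof (rule sum.cong)
      fix k assume k: "k \<in> {p + q..n - s}"
      have "(\<Sum>i\<in>{p..n - q - s}. scale (f $$ i * g $$ (k - i)) (v $$ (n - k))) =
          (\<Sum>i\<in>{p..k - q}. scale (f $$ i * g $$ (k - i)) (v $$ (n - k)))"
        using k by (intro sum.mono_neutral_right) (auto simp: z')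
      then show "(\<Sum>i\<in>{p..n - q - s}. scale (f $$ i * g $$ (k - i)) (v $$ (n - k))) =
          scale ((f * g) $$ k) (v $$ (n - k))"
        by (simp add: fg scale_sum_left)
    qed simp
    also have "\<dots> = fls_act scale (f * g) v $$ n"
      using z'' by (intro fls_act_nth_eq_sum_interval[symmetric]) (auto simp: fg)
    finally show "fls_act scale f (fls_act scale g v) $$ n = fls_act scale (f * g) v $$ n" .
  qed
  show "fls_act scale 1 v = v"
  proof (rule fls_eqI)
    fix n
    have "fls_act scale 1 v $$ n = (\<Sum>i\<in>{0}. scale (1 $$ i) (v $$ (n - i)))"
      by (rule fls_act_nth_eq_sum) (auto split: if_splits)
    then show "fls_act scale 1 v $$ n = v $$ n"
      by simp
  qed
qed

lemma fls_act_fls_const_nth: "fls_act scale (fls_const c) v $$ n = scale c (v $$ n)"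
  by (subst fls_act_nth_eq_sum[of "{0}"]) (auto split: if_splits)

lemma fls_act_X_nth: "fls_act scale fls_X v $$ n = v $$ (n - 1)"
  by (subst fls_act_nth_eq_sum[of "{1}"]) (auto split: if_splits)

lemma fls_act_X_inv_nth: "fls_act scale fls_X_inv v $$ n = v $$ (n + 1)"
  by (subst fls_act_nth_eq_sum[of "{-1}"]) (auto split: if_splits)

end

section \<open>Polynomials acting on series in two variables\<close>

locale complex_vector_space = vector_space scale
  for scale :: "complex \<Rightarrow> 'w::ab_group_add \<Rightarrow> 'w"
begin

abbreviation polyact where "polyact \<equiv> mult_poly2 scale"

lemma polyact_0 [simp]: "polyact 0 F = (\<lambda>m n w. 0)"
  by (simp add: mult_poly2_def fun_eq_iff)

text \<open>
  Horner's scheme, first in \<open>x\<^sub>1\<close> and then in \<open>x\<^sub>2\<close>. These two equations replace the double sum in inductions over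
  polynomials. The first one loops as a rewrite rule unless \<open>p\<close> is instantiated, since \<open>[:c:]\<close> is itself a \<open>pCons\<close>.
\<close>

lemma polyact_pCons:
  "polyact (pCons c p) F m n w = polyact [:c:] F m n w + polyact p (\<lambda>m. F (m - 1)) m n w"
proof (cases "p = 0")
  case False
  then show ?thesis
    by (simp add: mult_poly2_def sum.atMost_Suc_shift algebra_simps del: sum.atMost_Suc)
qed simp

lemma polyact_const_pCons:
  "polyact [:pCons a q:] F m n w = scale a (F m n w) + polyact [:q:] (\<lambda>m n. F m (n - 1)) m n w"
  by (cases "q = 0") (simp_all add: mult_poly2_def sum.atMost_Suc_shift algebra_simps del: sum.atMost_Suc)

lemma polyact_0_right [simp]: "polyact p (\<lambda>m n w. 0) = (\<lambda>m n w. 0)"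
  by (simp add: mult_poly2_def fun_eq_iff)

lemma polyact_add_right:
  "polyact p (\<lambda>m n w. F m n w + F' m n w) m n w = polyact p F m n w + polyact p F' m n w"
  by (simp add: mult_poly2_def scale_right_distrib sum.distrib)

lemma polyact_diff_right:
  "polyact p (\<lambda>m n w. F m n w - F' m n w) m n w = polyact p F m n w - polyact p F' m n w"
  by (simp add: mult_poly2_def scale_right_diff_distrib sum_subtractf)

lemma polyact_scale_right:
  "polyact p (\<lambda>m n w. scale c (F m n w)) m n w = scale c (polyact p F m n w)"
  by (simp add: mult_poly2_def scale_sum_right mult.commute)

lemma polyact_sum_right:
  "polyact p (\<lambda>m n w. \<Sum>k\<in>I. F k m n w) m n w = (\<Sum>k\<in>I. polyact p (F k) m n w)"
proof -
  have "polyact p (\<lambda>m n w. \<Sum>k\<in>I. F k m n w) m n w =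
      (\<Sum>i\<le>degree p. \<Sum>k\<in>I. \<Sum>j\<le>degree (coeff p i).
        scale (coeff (coeff p i) j) (F k (m - int i) (n - int j) w))"
    unfolding mult_poly2_def scale_sum_right by (intro sum.cong refl sum.swap)
  also have "\<dots> = (\<Sum>k\<in>I. polyact p (F k) m n w)"
    unfolding mult_poly2_def by (rule sum.swap)
  finally show ?thesis .
qed

lemma polyact_shift1: "polyact p (\<lambda>m. F (m - i)) m n w = polyact p F (m - i) n w"
  by (simp add: mult_poly2_def algebra_simps)

lemma polyact_shift2: "polyact p (\<lambda>m n. F m (n - j)) m n w = polyact p F m (n - j) w"
  by (simp add: mult_poly2_def algebra_simps)

lemma polyact_const_add_left: "polyact [:c + d:] F m n w = polyact [:c:] F m n w + polyact [:d:] F m n w"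
  by (induction c d arbitrary: F rule: poly_induct2)
     (simp_all add: polyact_const_pCons scale_left_distrib algebra_simps)

lemma polyact_add_left: "polyact (p + q) F m n w = polyact p F m n w + polyact q F m n w"
proof (induction p q arbitrary: F rule: poly_induct2)
  case (pCons c p d q)
  then show ?case
    by (simp add: polyact_pCons[of "c + d" "p + q"] polyact_pCons[of c p] polyact_pCons[of d q]
        polyact_const_add_left algebra_simps)
qed simp

lemma polyact_const_smult: "polyact [:smult a d:] F m n w = scale a (polyact [:d:] F m n w)"
  by (induction d arbitrary: F) (simp_all add: polyact_const_pCons scale_right_distrib)

lemma polyact_const_mult: "polyact [:c * d:] F m n w = polyact [:c:] (polyact [:d:] F) m n w"
proof (induction c arbitrary: m n w)
  case (pCons a c)
  have "polyact [:pCons 0 (c * d):] F m n w = polyact [:c * d:] F m (n - 1) w"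
    by (simp add: polyact_const_pCons polyact_shift2)
  then show ?case
    by (simp add: polyact_const_add_left polyact_const_smult polyact_const_pCons[of a]
        polyact_shift2 pCons.IH)
qed simp

lemma polyact_const_mult_left: "polyact (smult c p) F m n w = polyact [:c:] (polyact p F) m n w"
proof (induction p arbitrary: F m n w)
  case (pCons d p)
  have "polyact [:c:] (polyact (pCons d p) F) m n w =
     polyact [:c:] (\<lambda>m n w. polyact [:d:] F m n w + polyact p (\<lambda>m. F (m - 1)) m n w) m n w"
    by (simp add: polyact_pCons[of d p, abs_def])
  also have "\<dots> = polyact [:c * d:] F m n w + polyact (smult c p) (\<lambda>m. F (m - 1)) m n w"
    by (simp add: polyact_add_right polyact_const_mult pCons.IH)
  also have "\<dots> = polyact (smult c (pCons d p)) F m n w"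
    by (simp add: polyact_pCons[of "c * d" "smult c p"])
  finally show ?case ..
qed simp

lemma polyact_mult: "polyact (p * q) F m n w = polyact p (polyact q F) m n w"
proof (induction p arbitrary: m n w)
  case (pCons c p)
  have "polyact (pCons 0 (p * q)) F m n w = polyact (p * q) F (m - 1) n w"
    by (subst polyact_pCons) (simp add: polyact_shift1)
  then show ?case
    by (simp add: polyact_add_left polyact_const_mult_left polyact_pCons[of c p] polyact_shift1 pCons.IH)
qed simp

lemma polyact_mult': "polyact (p * q) F = polyact p (polyact q F)"
  by (intro ext) (rule polyact_mult)

lemma linear_polyact:
  assumes "\<And>m n. Vector_Spaces.linear scale scale (F m n)"
  shows "Vector_Spaces.linear scale scale (polyact p F m n)"
  using assms by (auto simp: Vector_Spaces.linear_iff mult_poly2_def scale_right_distrib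
      sum.distrib scale_sum_right mult.commute)

end

section \<open>Derivatives of delta functions\<close>

lemma emb_x_pCons: "emb_x (pCons a q) = fls_const a + fls_X_inv * emb_x q"
  by (simp add: emb_x_def map_poly_pCons)

lemma emb_x_affine: "emb_x [:\<beta>, \<alpha>:] = fls_const \<beta> + fls_const \<alpha> * fls_X_inv"
  by (simp only: emb_x_pCons emb_x_hom pCons_0_0 mult_zero_right add_0_right mult.commute)

lemma xderiv_add: "xderiv (f + g) = xderiv f + xderiv g"
  by (simp add: xderiv_def algebra_simps)

lemma xderiv_mult: "xderiv (f * g) = xderiv f * g + f * xderiv g"
  by (simp add: xderiv_def algebra_simps)

lemma xderiv_const: "xderiv (fls_const c) = 0"
  by (simp add: xderiv_def)

lemma xderiv_X_inv: "xderiv fls_X_inv = 1"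
  by (simp add: xderiv_def fls_X_power_times_conv_shift fls_X_inv_power_conv_shift_1)

text \<open>
  The Leibniz rule, which has only two terms because the second derivative of an affine map vanishes.
\<close>

lemma xderiv_funpow_affine_mult:
  fixes \<alpha> \<beta> :: complex
  shows "(xderiv ^^ j) (emb_x [:\<beta>, \<alpha>:] * f) =
     emb_x [:\<beta>, \<alpha>:] * (xderiv ^^ j) f + of_nat j * fls_const \<alpha> * (xderiv ^^ (j - 1)) f"
proof (induction j)
  case (Suc j)
  let ?g = "emb_x [:\<beta>, \<alpha>:]" and ?T = "of_nat j * fls_const \<alpha> * (xderiv ^^ (j - 1)) f"
  have g: "xderiv ?g = fls_const \<alpha>"
    by (simp only: emb_x_affine xderiv_add xderiv_mult xderiv_const xderiv_X_inv) simp
  have T: "xderiv ?T = of_nat j * fls_const \<alpha> * (xderiv ^^ j) f"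
    using xderiv_const[of 0] by (cases j) (simp_all add: fls_of_nat xderiv_mult xderiv_const
        del: of_nat_Suc fls_const_mult_const)
  have "(xderiv ^^ Suc j) (?g * f) = xderiv (?g * (xderiv ^^ j) f + ?T)"
    by (simp only: funpow.simps o_apply Suc.IH)
  also have "\<dots> = fls_const \<alpha> * (xderiv ^^ j) f + ?g * (xderiv ^^ Suc j) f +
      of_nat j * fls_const \<alpha> * (xderiv ^^ j) f"
    by (simp only: xderiv_add xderiv_mult[of ?g] g T funpow.simps o_apply)
  also have "\<dots> = ?g * (xderiv ^^ Suc j) f + of_nat (Suc j) * fls_const \<alpha> * (xderiv ^^ j) f"
    by (simp add: distrib_right)
  finally show ?case
    by simp
qed simp

lemma affine_powi_0: "affine_powi g 0 = 1"
  by (intro fls_eqI) (simp add: affine_powi_nth gbinomial_0_left)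

text \<open>
  The powers of \<open>g\<close> are given by their binomial expansions, also for negative exponents, so that this is
  Pascal's rule on the coefficients.
\<close>

lemma affine_powi_plus_1:
  assumes "\<alpha> \<noteq> 0"
  shows "affine_powi [:\<beta>, \<alpha>:] (n + 1) = emb_x [:\<beta>, \<alpha>:] * affine_powi [:\<beta>, \<alpha>:] n"
proof (rule fls_eqI)
  fix l
  let ?P = "affine_powi [:\<beta>, \<alpha>:]"
  have "(emb_x [:\<beta>, \<alpha>:] * ?P n) $$ l = \<beta> * ?P n $$ l + \<alpha> * ?P n $$ (l + 1)"
    unfolding emb_x_affine by (simp add: distrib_right mult.assoc fls_X_inv_times_conv_shift(1))
  also have "\<dots> = ?P (n + 1) $$ l"
  proof (cases "0 \<le> n + l")
    case True
    then obtain k where k: "n + l = int k"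
      using zero_le_imp_eq_int by blast
    then have *: "nat (n + l) = k" "nat (n + (l + 1)) = Suc k" "nat (n + 1 + l) = Suc k"
      by auto
    have "\<alpha> powi (- l) = \<alpha> powi (- (l + 1)) * \<alpha>"
      using assms by (simp flip: power_int_add_1)
    then show ?thesis
      using True unfolding affine_powi_nth *
      using gbinomial_Suc_Suc[of "of_int n :: complex" k] by (simp add: algebra_simps)
  next
    case False
    show ?thesis
    proof (cases "n + l = -1")
      case True
      then have "n = - l - 1" by simp
      then show ?thesis
        using assms by (simp add: affine_powi_nth flip: power_int_add_1')
    qed (use False in \<open>simp add: affine_powi_nth\<close>)
  qed
  finally show "?P (n + 1) $$ l = (emb_x [:\<beta>, \<alpha>:] * ?P n) $$ l" ..
qed

text \<open>
  Multiplication by \<open>x\<^sub>1\<close> acts on \<open>x\<^sub>1\<^sup>-\<^sup>1 \<delta>(g(x\<^sub>2)/x\<^sub>1)\<close> as \<open>g(x\<^sub>2)\<close>. Differentiating this \<open>j\<close> times in \<open>x\<^sub>2\<close> gives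
  one further term, from the derivative \<open>\<alpha>\<close> of \<open>g\<close>.
\<close>

lemma delta_deriv_shift:
  assumes "\<alpha> \<noteq> 0"
  shows "delta_deriv j [:\<beta>, \<alpha>:] (m - 1) = emb_x [:\<beta>, \<alpha>:] * delta_deriv j [:\<beta>, \<alpha>:] m +
    (if j = 0 then 0 else fls_const \<alpha> * delta_deriv (j - 1) [:\<beta>, \<alpha>:] m)"
proof -
  have "delta_deriv j [:\<beta>, \<alpha>:] (m - 1) = fls_const (1 / fact j) *
      (xderiv ^^ j) (emb_x [:\<beta>, \<alpha>:] * affine_powi [:\<beta>, \<alpha>:] (- m - 1))"
    using affine_powi_plus_1[OF assms, of \<beta> "- m - 1"] by (simp add: delta_deriv_def)
  moreover have "fls_const (1 / fact j) * (emb_x [:\<beta>, \<alpha>:] * f + of_nat j * fls_const \<alpha> * h) =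
      emb_x [:\<beta>, \<alpha>:] * (fls_const (1 / fact j) * f) +
      (if j = 0 then 0 else fls_const \<alpha> * (fls_const (1 / fact (j - 1)) * h))" for f h
  proof (cases "j = 0")
    case False
    then have *: "fls_const (1 / fact j) * of_nat j = (fls_const (1 / fact (j - 1)) :: complex fls)"
      by (cases j) (simp_all add: fls_of_nat del: of_nat_Suc)
    have "fls_const (1 / fact j) * (of_nat j * fls_const \<alpha> * h) =
        fls_const \<alpha> * ((fls_const (1 / fact j) * of_nat j) * h)"
      by (simp only: ac_simps)
    then have "fls_const (1 / fact j) * (of_nat j * fls_const \<alpha> * h) =
        fls_const \<alpha> * (fls_const (1 / fact (j - 1)) * h)"
      unfolding * .
    moreover have "fls_const (1 / fact j) * (emb_x [:\<beta>, \<alpha>:] * f) =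
        emb_x [:\<beta>, \<alpha>:] * (fls_const (1 / fact j) * f)"
      by (rule mult.left_commute)
    ultimately show ?thesis
      using False by (simp only: distrib_left if_False)
  qed simp
  ultimately show ?thesis
    unfolding delta_deriv_def xderiv_funpow_affine_mult by (rule trans)
qed

lemma delta_deriv_minus_1: "delta_deriv j g (- 1) = (if j = 0 then 1 else 0)"
proof (cases j)
  case (Suc i)
  have "xderiv 1 = 0" "xderiv 0 = 0"
    using xderiv_const[of 1] xderiv_const[of 0] by simp_all
  moreover from this have "(xderiv ^^ i) 0 = 0"
    by (induction i) simp_all
  ultimately show ?thesis
    by (simp add: Suc delta_deriv_def affine_powi_0 funpow_Suc_right del: funpow.simps)
qed (simp add: delta_deriv_def affine_powi_0)

text \<open>
  The outer variable of \<open>x1_minus g\<close> is \<open>x\<^sub>1\<close>, and that of \<open>expand_x1 p = p(x + x\<^sub>0, x)\<close> is \<open>x\<^sub>0\<close>.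
\<close>

abbreviation x1_minus :: "complex poly \<Rightarrow> complex poly poly" where
  "x1_minus g \<equiv> [:- g, 1:]"

abbreviation expand_x1 :: "complex poly poly \<Rightarrow> complex poly poly" where
  "expand_x1 p \<equiv> pcompose p [:[:0, 1:], 1:]"

context complex_vector_space
begin

sublocale fls: module "fls_act scale"
  by (rule module_fls_act)

sublocale fls2: module "fls_act (fls_act scale)"
  by (rule fls.module_fls_act)

abbreviation delta_term where
  "delta_term j g v \<equiv> \<lambda>m n w. xcoeff (fls_act scale (delta_deriv j g m) (v w)) n"

text \<open>
  For a fixed power of \<open>x\<^sub>1\<close>, the delta functions are Laurent series in \<open>x\<^sub>2\<^sup>-\<^sup>1\<close>. Polynomials in \<open>x\<^sub>2\<close> act on them through
  the module structure, which makes the equations between delta functions applicable.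
\<close>

lemma polyact_const_row:
  "polyact [:c:] (\<lambda>m n w. xcoeff (v m w) n) m n w = xcoeff (fls_act scale (emb_x c) (v m w)) n"
proof (induction c arbitrary: v)
  case (pCons a c)
  have "(\<lambda>m n w. xcoeff (v m w) (n - 1)) = (\<lambda>m n w. xcoeff (fls_act scale fls_X_inv (v m w)) n)"
    by (simp add: xcoeff_def fls_act_X_inv_nth)
  then have "polyact [:c:] (\<lambda>m n w. xcoeff (v m w) (n - 1)) m n w =
      xcoeff (fls_act scale (emb_x c) (fls_act scale fls_X_inv (v m w))) n"
    using pCons.IH[of "\<lambda>m w. fls_act scale fls_X_inv (v m w)"] by simp
  then show ?case
    by (simp add: polyact_const_pCons emb_x_pCons fls.scale_left_distrib mult.commute
        xcoeff_def fls_act_fls_const_nth)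
qed (simp add: emb_x_hom xcoeff_def)

lemma polyact_x1_minus:
  "polyact (x1_minus g) F m n w = F (m - 1) n w - polyact [:g:] F m n w"
proof -
  have "polyact [:- g:] F m n w = - polyact [:g:] F m n w"
    using polyact_const_smult[of "- 1" g F m n w] by simp
  moreover have "polyact [:1:] F m n w = F m n w" for F
    by (simp add: mult_poly2_def)
  ultimately show ?thesis
    using polyact_pCons[of "- g" "[:1:]" F m n w] by simp
qed

lemma polyact_x1_minus_x2:
  "polyact (x1_minus [:0, 1:]) F m n w = F (m - 1) n w - F m (n - 1) w"
  unfolding polyact_x1_minus by (simp add: polyact_const_pCons)

lemma polyact_x1_minus_delta_term:
  assumes "g \<in> affine_G"
  shows "polyact (x1_minus g) (delta_term j g v) =
    (\<lambda>m n w. if j = 0 then 0 else scale (coeff g 1) (delta_term (j - 1) g v m n w))"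
proof (intro ext)
  fix m n w
  obtain \<alpha> \<beta> where g: "g = [:\<beta>, \<alpha>:]" "\<alpha> \<noteq> 0"
    using assms by (auto simp: affine_G_def)
  show "polyact (x1_minus g) (delta_term j g v) m n w =
      (if j = 0 then 0 else scale (coeff g 1) (delta_term (j - 1) g v m n w))"
    unfolding polyact_x1_minus polyact_const_row
    by (simp add: g delta_deriv_shift fls.scale_left_distrib xcoeff_def fls_act_fls_const_nth
        flip: fls.scale_scale)
qed

text \<open>
  Each factor lowers the order of the derivative by one, and the delta function itself is annihilated.
\<close>

lemma polyact_x1_minus_power_delta_term:
  assumes "g \<in> affine_G" "j < s"
  shows "polyact (x1_minus g ^ s) (delta_term j g v) = (\<lambda>m n w. 0)"
  using assms(2)
proof (induction s arbitrary: j)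
  case (Suc s)
  have "polyact (x1_minus g ^ Suc s) (delta_term j g v) =
      polyact (x1_minus g ^ s) (polyact (x1_minus g) (delta_term j g v))"
    by (simp only: polyact_mult' power_Suc2)
  also have "\<dots> = (\<lambda>m n w. 0)"
  proof (cases j)
    case 0
    then show ?thesis
      by (simp add: polyact_x1_minus_delta_term[OF assms(1)])
  next
    case (Suc i)
    then have "polyact (x1_minus g ^ s) (delta_term i g v) = (\<lambda>m n w. 0)"
      using Suc.IH[of i] Suc.prems by simp
    then show ?thesis
      by (simp add: Suc polyact_x1_minus_delta_term[OF assms(1)] polyact_scale_right fun_eq_iff)
  qed
  finally show ?case .
qed simp

text \<open>
  The coefficient of \<open>x\<^sub>1\<^sup>-\<^sup>1\<close> is the residue in \<open>x\<^sub>1\<close>. That of \<open>q(x\<^sub>1, x\<^sub>2) 1/j! (\<partial>/\<partial>x\<^sub>2) ^ j x\<^sub>1\<^sup>-\<^sup>1 \<delta>(x\<^sub>2/x\<^sub>1)\<close> is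
  \<open>1/j! (\<partial>/\<partial>x\<^sub>1) ^ j q\<close> at \<open>x\<^sub>1 = x\<^sub>2\<close>, the \<open>j\<close>-th Taylor coefficient. The induction compares Horner's scheme for
  \<open>q\<close> on both sides: \<open>x\<^sub>1\<close> acts on the sequence of derivatives as \<open>x + x\<^sub>0\<close> acts on the powers of \<open>x\<^sub>0\<close>.
\<close>

lemma polyact_delta_term_residue:
  "polyact q (delta_term j [:0, 1:] v) (- 1) n w =
     xcoeff (fls_act scale (emb_x (coeff (expand_x1 q) j)) (v w)) n"
proof (induction q arbitrary: j n)
  case (pCons c q)
  let ?x = "[:0, 1:] :: complex poly"
  let ?e = "\<lambda>j. emb_x (coeff (expand_x1 q) j)"
  have x: "emb_x ?x = fls_X_inv"
    by (simp add: emb_x_pCons emb_x_hom)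
  have shift: "delta_term j ?x v (m - 1) n w =
      delta_term j ?x v m (n - 1) w + (if j = 0 then 0 else delta_term (j - 1) ?x v m n w)" for m n w
    by (simp add: delta_deriv_shift x fls.scale_left_distrib xcoeff_def fls_act_X_inv_nth
          flip: fls.scale_scale)
  have "polyact q (\<lambda>m. delta_term j ?x v (m - 1)) (- 1) n w =
      polyact q (delta_term j ?x v) (- 1) (n - 1) w +
      (if j = 0 then 0 else polyact q (delta_term (j - 1) ?x v) (- 1) n w)"
    unfolding shift polyact_shift2[of q "delta_term j ?x v", symmetric]
    by (cases "j = 0") (simp_all add: polyact_add_right)
  moreover have "coeff (expand_x1 (pCons c q)) j =
      (if j = 0 then c else 0) + pCons 0 (coeff (expand_x1 q) j) +
      (if j = 0 then 0 else coeff (expand_x1 q) (j - 1))"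
    by (cases j) (simp_all add: pcompose_pCons)
  ultimately show ?case
    unfolding polyact_pCons[of c q] polyact_const_row pCons.IH delta_deriv_minus_1
    by (auto simp: emb_x_hom emb_x_pCons[of 0] fls.scale_left_distrib xcoeff_def fls_act_X_inv_nth
         simp flip: fls.scale_scale)
qed (simp add: emb_x_hom xcoeff_def)

end

section \<open>The substitution \<open>x\<^sub>1 = x + x\<^sub>0\<close>\<close>

lemma emb_x_x0_pCons: "emb_x_x0 (pCons c p) = fls_const (emb_x c) + fls_X * emb_x_x0 p"
  by (simp add: emb_x_x0_def map_poly_pCons emb_x_hom)

text \<open>
  Truncation in both variables at a single vector \<open>w\<close>. Unlike membership in \<open>Hom_trunc2\<close> it does not demand
  linearity, so that it is preserved by all operations on series without side conditions.
\<close>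

definition bounded_at :: "(int \<Rightarrow> int \<Rightarrow> 'w \<Rightarrow> 'w) \<Rightarrow> 'w::zero \<Rightarrow> bool" where
  "bounded_at F w \<longleftrightarrow> (\<exists>M N. \<forall>m n. F m n w \<noteq> 0 \<longrightarrow> m \<le> M \<and> n \<le> N)"

lemma bounded_atI: "(\<And>m n. F m n w \<noteq> 0 \<Longrightarrow> m \<le> M \<and> n \<le> N) \<Longrightarrow> bounded_at F w"
  by (auto simp: bounded_at_def)

context complex_vector_space
begin

lemma bounded_at_shift1:
  assumes "bounded_at F w"
  shows "bounded_at (\<lambda>m. F (m - 1)) w"
proof -
  obtain M N where "\<And>m n. F m n w \<noteq> 0 \<Longrightarrow> m \<le> M \<and> n \<le> N"
    using assms unfolding bounded_at_def by blast
  then have "F (m - 1) n w \<noteq> 0 \<longrightarrow> m \<le> M + 1 \<and> n \<le> N" for m n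
    by force
  then show ?thesis by (blast intro: bounded_atI)
qed

lemma bounded_at_shift2:
  assumes "bounded_at F w"
  shows "bounded_at (\<lambda>m n. F m (n - 1)) w"
proof -
  obtain M N where "\<And>m n. F m n w \<noteq> 0 \<Longrightarrow> m \<le> M \<and> n \<le> N"
    using assms unfolding bounded_at_def by blast
  then have "F m (n - 1) w \<noteq> 0 \<longrightarrow> m \<le> M \<and> n \<le> N + 1" for m n
    by force
  then show ?thesis by (blast intro: bounded_atI)
qed

lemma bounded_at_common:
  assumes "bounded_at F w" "bounded_at F' w"
  shows "\<exists>M N. \<forall>m n. F m n w \<noteq> 0 \<or> F' m n w \<noteq> 0 \<longrightarrow> m \<le> M \<and> n \<le> N"
proof -
  obtain M N where 1: "\<And>m n. F m n w \<noteq> 0 \<Longrightarrow> m \<le> M \<and> n \<le> N"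
    using assms(1) unfolding bounded_at_def by blast
  obtain M' N' where 2: "\<And>m n. F' m n w \<noteq> 0 \<Longrightarrow> m \<le> M' \<and> n \<le> N'"
    using assms(2) unfolding bounded_at_def by blast
  have "F m n w \<noteq> 0 \<or> F' m n w \<noteq> 0 \<longrightarrow> m \<le> max M M' \<and> n \<le> max N N'" for m n
    using 1[of m n] 2[of m n] by (auto simp: le_max_iff_disj)
  then show ?thesis by blast
qed

lemma bounded_at_add:
  fixes w :: 'w
  assumes "bounded_at F w" "bounded_at F' w"
  shows "bounded_at (\<lambda>m n w. F m n w + F' m n w) w"
proof -
  obtain M N where *: "\<And>m n. F m n w \<noteq> 0 \<or> F' m n w \<noteq> 0 \<Longrightarrow> m \<le> M \<and> n \<le> N"
    using bounded_at_common[OF assms] by blast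
  have "F m n w + F' m n w \<noteq> 0 \<longrightarrow> m \<le> M \<and> n \<le> N" for m n
    using *[of m n] by (cases "F m n w = 0") auto
  then show ?thesis by (blast intro: bounded_atI)
qed

lemma bounded_at_zero: "bounded_at (\<lambda>m n w. 0) w"
  by (simp add: bounded_at_def)

lemma bounded_at_scale:
  assumes "bounded_at F w"
  shows "bounded_at (\<lambda>m n w. scale c (F m n w)) w"
  using assms by (fastforce simp: bounded_at_def)

text \<open>
  Truncation makes the sum in the definition finite and empty for small \<open>l\<close>. Enlarging the interval allows
  series with different bounds to be compared term by term.
\<close>

lemma subst_nth_interval:
  assumes F: "\<And>m n. F m n w \<noteq> 0 \<Longrightarrow> m \<le> M \<and> n \<le> N"
    and LU: "L \<le> int i - l - N" "M \<le> U"
  shows "subst_x_plus_x0 scale F w $$ int i $$ l =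
    (\<Sum>m\<in>{L..U}. scale (of_int m gchoose i) (F m (int i - m - l) w))"
proof -
  let ?S = "\<lambda>l. {m. F m (int i - m - l) w \<noteq> 0}"
  have S: "?S l \<subseteq> {int i - l - N..M}" for l
    using F by fastforce
  have "subst_x_plus_x0 scale F w $$ int i $$ l =
      (\<Sum>m\<in>?S l. scale (of_int m gchoose i) (F m (int i - m - l) w))"
  proof -
    have "Abs_fls (\<lambda>l. \<Sum>m\<in>?S l. scale (of_int m gchoose i) (F m (int i - m - l) w)) $$ l =
      (\<Sum>m\<in>?S l. scale (of_int m gchoose i) (F m (int i - m - l) w))"
    proof (rule nth_Abs_fls_lower_bound[of "int i - N - M"], intro allI impI)
      fix l assume "l < int i - N - M"
      then have "?S l = {}"
        using S[of l] by auto
      then show "(\<Sum>m\<in>?S l. scale (of_int m gchoose i) (F m (int i - m - l) w)) = 0"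
        by simp
    qed
    then show ?thesis
      by (simp add: subst_x_plus_x0_def)
  qed
  also have "\<dots> = (\<Sum>m\<in>{L..U}. scale (of_int m gchoose i) (F m (int i - m - l) w))"
  proof (rule sum.mono_neutral_left)
    show "?S l \<subseteq> {L..U}"
      using S[of l] LU by fastforce
  qed auto
  finally show ?thesis .
qed

lemma subst_nth_neg: "n < 0 \<Longrightarrow> subst_x_plus_x0 scale F w $$ n = 0"
  by (simp add: subst_x_plus_x0_def)

lemma subst_eqI:
  assumes "\<And>n. n < 0 \<Longrightarrow> V $$ n = 0" "\<And>i l. subst_x_plus_x0 scale F w $$ int i $$ l = V $$ int i $$ l"
  shows "subst_x_plus_x0 scale F w = V"
proof (intro fls_eqI)
  fix n l
  show "subst_x_plus_x0 scale F w $$ n $$ l = V $$ n $$ l"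
    by (cases n) (use assms subst_nth_neg in auto)
qed

lemma subst_zero: "subst_x_plus_x0 scale (\<lambda>m n w. 0) w = 0"
proof (rule subst_eqI)
  fix i l
  have "subst_x_plus_x0 scale (\<lambda>m n w. 0) w $$ int i $$ l =
      (\<Sum>m\<in>{int i - l..0}. scale (of_int m gchoose i) 0)"
    by (rule subst_nth_interval[where M = 0 and N = 0]) simp_all
  then show "subst_x_plus_x0 scale (\<lambda>m n w. 0) w $$ int i $$ l = 0 $$ int i $$ l"
    by simp
qed simp

lemma subst_add:
  assumes "bounded_at F w" "bounded_at F' w"
  shows "subst_x_plus_x0 scale (\<lambda>m n w. F m n w + F' m n w) w =
    subst_x_plus_x0 scale F w + subst_x_plus_x0 scale F' w"
proof (rule subst_eqI)
  fix i l
  obtain M N where *: "\<And>m n. F m n w \<noteq> 0 \<or> F' m n w \<noteq> 0 \<Longrightarrow> m \<le> M \<and> n \<le> N"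
    using bounded_at_common[OF assms] by blast
  let ?I = "{int i - l - N..M}"
  have "subst_x_plus_x0 scale F w $$ int i $$ l =
      (\<Sum>m\<in>?I. scale (of_int m gchoose i) (F m (int i - m - l) w))"
    by (rule subst_nth_interval) (use * in auto)
  moreover have "subst_x_plus_x0 scale F' w $$ int i $$ l =
      (\<Sum>m\<in>?I. scale (of_int m gchoose i) (F' m (int i - m - l) w))"
    by (rule subst_nth_interval) (use * in auto)
  moreover have "subst_x_plus_x0 scale (\<lambda>m n w. F m n w + F' m n w) w $$ int i $$ l =
      (\<Sum>m\<in>?I. scale (of_int m gchoose i) (F m (int i - m - l) w + F' m (int i - m - l) w))"
  proof (rule subst_nth_interval)
    show "m \<le> M \<and> n \<le> N" if "F m n w + F' m n w \<noteq> 0" for m n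
      using *[of m n] that by (cases "F m n w = 0") auto
  qed simp_all
  ultimately show "subst_x_plus_x0 scale (\<lambda>m n w. F m n w + F' m n w) w $$ int i $$ l =
      (subst_x_plus_x0 scale F w + subst_x_plus_x0 scale F' w) $$ int i $$ l"
    by (simp add: scale_right_distrib sum.distrib)
qed (simp add: subst_nth_neg)

lemma subst_scale:
  assumes "bounded_at F w"
  shows "subst_x_plus_x0 scale (\<lambda>m n w. scale c (F m n w)) w =
    fls_act (fls_act scale) (fls_const (fls_const c)) (subst_x_plus_x0 scale F w)"
proof (rule subst_eqI)
  fix i l
  obtain M N where *: "\<And>m n. F m n w \<noteq> 0 \<Longrightarrow> m \<le> M \<and> n \<le> N"
    using assms unfolding bounded_at_def by blast
  let ?I = "{int i - l - N..M}"
  have "subst_x_plus_x0 scale F w $$ int i $$ l =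
      (\<Sum>m\<in>?I. scale (of_int m gchoose i) (F m (int i - m - l) w))"
    by (rule subst_nth_interval) (use * in auto)
  moreover have "subst_x_plus_x0 scale (\<lambda>m n w. scale c (F m n w)) w $$ int i $$ l =
      (\<Sum>m\<in>?I. scale (of_int m gchoose i) (scale c (F m (int i - m - l) w)))"
    by (rule subst_nth_interval) (use * in auto)
  ultimately show "subst_x_plus_x0 scale (\<lambda>m n w. scale c (F m n w)) w $$ int i $$ l =
    fls_act (fls_act scale) (fls_const (fls_const c)) (subst_x_plus_x0 scale F w) $$ int i $$ l"
    by (simp add: fls.fls_act_fls_const_nth fls_act_fls_const_nth scale_sum_right mult.commute)
qed (simp add: subst_nth_neg fls.fls_act_fls_const_nth)

lemma subst_shift2:
  assumes "bounded_at F w"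
  shows "subst_x_plus_x0 scale (\<lambda>m n. F m (n - 1)) w =
    fls_act (fls_act scale) (fls_const fls_X_inv) (subst_x_plus_x0 scale F w)"
proof (rule subst_eqI)
  fix i l
  obtain M N where *: "\<And>m n. F m n w \<noteq> 0 \<Longrightarrow> m \<le> M \<and> n \<le> N"
    using assms unfolding bounded_at_def by blast
  then have **: "m \<le> M \<and> n \<le> N + 1" if "F m (n - 1) w \<noteq> 0" for m n
    using that by force
  have "subst_x_plus_x0 scale (\<lambda>m n. F m (n - 1)) w $$ int i $$ l =
      (\<Sum>m = int i - l - (N + 1)..M. scale (of_int m gchoose i) (F m (int i - m - l - 1) w))"
    by (rule subst_nth_interval) (use ** in auto)
  moreover have "subst_x_plus_x0 scale F w $$ int i $$ (l + 1) =
      (\<Sum>m = int i - l - (N + 1)..M. scale (of_int m gchoose i) (F m (int i - m - (l + 1)) w))"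
    by (rule subst_nth_interval) (use * in auto)
  ultimately show "subst_x_plus_x0 scale (\<lambda>m n. F m (n - 1)) w $$ int i $$ l =
    fls_act (fls_act scale) (fls_const fls_X_inv) (subst_x_plus_x0 scale F w) $$ int i $$ l"
    by (simp add: fls.fls_act_fls_const_nth fls_act_X_inv_nth algebra_simps)
qed (simp add: subst_nth_neg fls.fls_act_fls_const_nth)

text \<open>
  On the coefficients this is Pascal's rule for \<open>m gchoose i\<close>.
\<close>

lemma subst_shift1:
  assumes "bounded_at F w"
  shows "subst_x_plus_x0 scale (\<lambda>m. F (m - 1)) w =
    fls_act (fls_act scale) (fls_const fls_X_inv + fls_X) (subst_x_plus_x0 scale F w)"
proof (rule subst_eqI)
  let ?T = "subst_x_plus_x0 scale"
  fix i l
  obtain M N where *: "\<And>m n. F m n w \<noteq> 0 \<Longrightarrow> m \<le> M \<and> n \<le> N"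
    using assms unfolding bounded_at_def by blast
  then have **: "m \<le> M + 1 \<and> n \<le> N" if "F (m - 1) n w \<noteq> 0" for m n
    using that by force
  let ?L = "int i - l - N - 1"
  have "?T (\<lambda>m. F (m - 1)) w $$ int i $$ l =
      (\<Sum>m = ?L + 1..M + 1. scale (of_int m gchoose i) (F (m - 1) (int i - m - l) w))"
    by (rule subst_nth_interval) (use ** in auto)
  also have "\<dots> = (\<Sum>m = ?L..M. scale (of_int (m + 1) gchoose i) (F m (int i - m - l - 1) w))"
    by (rule sum.reindex_bij_witness[of _ "\<lambda>m. m + 1" "\<lambda>m. m - 1"]) (auto simp: algebra_simps)
  also have "\<dots> = ?T F w $$ int i $$ (l + 1) + ?T F w $$ (int i - 1) $$ l"
  proof (cases i)
    case 0
  have "?T F w $$ int i $$ (l + 1) =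
        (\<Sum>m = ?L..M. scale (of_int m gchoose i) (F m (int i - m - (l + 1)) w))"
      by (rule subst_nth_interval) (use * in auto)
    then show ?thesis
      by (simp add: 0 subst_nth_neg algebra_simps)
  next
    case (Suc j)
    have "?T F w $$ int i $$ (l + 1) =
        (\<Sum>m = ?L..M. scale (of_int m gchoose i) (F m (int i - m - (l + 1)) w))"
      by (rule subst_nth_interval) (use * in auto)
    moreover have "?T F w $$ int j $$ l =
        (\<Sum>m = ?L..M. scale (of_int m gchoose j) (F m (int j - m - l) w))"
      by (rule subst_nth_interval) (use * Suc in auto)
    ultimately show ?thesis
      using gbinomial_Suc_Suc[of "of_int _ :: complex" j]
      by (simp add: Suc scale_left_distrib sum.distrib algebra_simps)
  qed
  finally show "?T (\<lambda>m. F (m - 1)) w $$ int i $$ l =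
    fls_act (fls_act scale) (fls_const fls_X_inv + fls_X) (?T F w) $$ int i $$ l"
    by (simp add: fls2.scale_left_distrib fls.fls_act_fls_const_nth fls_act_X_inv_nth fls.fls_act_X_nth)
qed (simp add: subst_nth_neg fls2.scale_left_distrib fls.fls_act_fls_const_nth fls.fls_act_X_nth)

lemma subst_polyact_const:
  assumes "bounded_at F w"
  shows "bounded_at (polyact [:c:] F) w \<and> subst_x_plus_x0 scale (polyact [:c:] F) w =
    fls_act (fls_act scale) (fls_const (emb_x c)) (subst_x_plus_x0 scale F w)"
  using assms
proof (induction c arbitrary: F)
  case 0
then show ?case
    by (simp add: emb_x_hom subst_zero bounded_at_zero)
next
  case (pCons a c)
  let ?F = "\<lambda>m n. F m (n - 1)"
  have e: "polyact [:pCons a c:] F = (\<lambda>m n w. scale a (F m n w) + polyact [:c:] ?F m n w)"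
    by (intro ext) (rule polyact_const_pCons)
  note 1 = bounded_at_scale[OF pCons.prems, of a] and IH = pCons.IH[OF bounded_at_shift2[OF pCons.prems]]
  show ?case
    unfolding e
  proof (intro conjI)
    show "bounded_at (\<lambda>m n w. scale a (F m n w) + polyact [:c:] ?F m n w) w"
      by (rule bounded_at_add[OF 1 conjunct1[OF IH]])
    have "subst_x_plus_x0 scale (\<lambda>m n w. scale a (F m n w) + polyact [:c:] ?F m n w) w =
      subst_x_plus_x0 scale (\<lambda>m n w. scale a (F m n w)) w + subst_x_plus_x0 scale (polyact [:c:] ?F) w"
      by (rule subst_add[OF 1 conjunct1[OF IH]])
    also have "\<dots> = fls_act (fls_act scale) (fls_const (emb_x (pCons a c))) (subst_x_plus_x0 scale F w)"
      unfolding conjunct2[OF IH] subst_scale[OF pCons.prems] subst_shift2[OF pCons.prems]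
        emb_x_pCons fls_plus_const[symmetric] fls_const_mult_const[symmetric]
      by (simp only: fls2.scale_left_distrib fls2.scale_scale mult.commute)
    finally show "subst_x_plus_x0 scale (\<lambda>m n w. scale a (F m n w) + polyact [:c:] ?F m n w) w = \<dots>" .
  qed
qed

text \<open>
  By Horner's scheme this follows from the cases of the two variables, which act as \<open>x + x\<^sub>0\<close> and \<open>x\<close>.
\<close>

lemma subst_polyact:
  assumes "bounded_at F w"
  shows "bounded_at (polyact p F) w" "subst_x_plus_x0 scale (polyact p F) w =
    fls_act (fls_act scale) (emb_x_x0 (expand_x1 p)) (subst_x_plus_x0 scale F w)"
proof -
  have "bounded_at (polyact p F) w \<and> subst_x_plus_x0 scale (polyact p F) w =
    fls_act (fls_act scale) (emb_x_x0 (expand_x1 p)) (subst_x_plus_x0 scale F w)"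
    using assms
  proof (induction p arbitrary: F)
    case 0
    then show ?case
      by (simp add: emb_x_x0_hom subst_zero bounded_at_zero)
  next
    case (pCons c p)
    let ?F = "\<lambda>m. F (m - 1)"
    have e: "polyact (pCons c p) F = (\<lambda>m n w. polyact [:c:] F m n w + polyact p ?F m n w)"
      by (intro ext) (rule polyact_pCons)
    have x: "emb_x_x0 (expand_x1 (pCons c p)) =
        fls_const (emb_x c) + emb_x_x0 (expand_x1 p) * (fls_const fls_X_inv + fls_X)"
    proof -
      have "emb_x_x0 [:[:0, 1:], 1:] = fls_const fls_X_inv + fls_X" "emb_x_x0 [:c:] = fls_const (emb_x c)"
        by (simp_all add: emb_x_x0_pCons emb_x_x0_hom emb_x_affine emb_x_hom)
      then show ?thesis
        by (simp only: pcompose_pCons emb_x_x0_hom mult.commute)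
    qed
    note 1 = conjunct1[OF subst_polyact_const[OF pCons.prems, of c]]
      and IH = pCons.IH[OF bounded_at_shift1[OF pCons.prems]]
    show ?case
      unfolding e
    proof (intro conjI)
      show "bounded_at (\<lambda>m n w. polyact [:c:] F m n w + polyact p ?F m n w) w"
        by (rule bounded_at_add[OF 1 conjunct1[OF IH]])
      have "subst_x_plus_x0 scale (\<lambda>m n w. polyact [:c:] F m n w + polyact p ?F m n w) w =
        subst_x_plus_x0 scale (polyact [:c:] F) w + subst_x_plus_x0 scale (polyact p ?F) w"
        by (rule subst_add[OF 1 conjunct1[OF IH]])
      also have "\<dots> = fls_act (fls_act scale) (emb_x_x0 (expand_x1 (pCons c p))) (subst_x_plus_x0 scale F w)"
        unfolding x
        by (simp only: conjunct2[OF IH] conjunct2[OF subst_polyact_const[OF pCons.prems]] subst_shift1[OF pCons.prems]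
             fls2.scale_scale fls2.scale_left_distrib[symmetric])
      finally show "subst_x_plus_x0 scale (\<lambda>m n w. polyact [:c:] F m n w + polyact p ?F m n w) w = \<dots>" .
    qed
  qed
  then show "bounded_at (polyact p F) w" "subst_x_plus_x0 scale (polyact p F) w =
    fls_act (fls_act scale) (emb_x_x0 (expand_x1 p)) (subst_x_plus_x0 scale F w)"
    by blast+
qed

end

section \<open>Coefficients of the substitution as residues\<close>

text \<open>
  Multiplication by \<open>x\<^sub>1 - x\<^sub>2\<close> preserves homogeneous components. On a component, written as a sequence indexed by
  the power of \<open>x\<^sub>1\<close>, it is the following difference operator.
\<close>

definition bdiff :: "(int \<Rightarrow> 'a) \<Rightarrow> int \<Rightarrow> 'a::ab_group_add" where
  "bdiff c m = c (m - 1) - c m"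

lemma bdiff_funpow_Suc: "(bdiff ^^ Suc t) c m = (bdiff ^^ t) c (m - 1) - (bdiff ^^ t) c m"
  by (simp add: bdiff_def)

lemma bdiff_funpow_zero_below:
  assumes "\<And>m. m < L \<Longrightarrow> c m = 0" "m < L"
  shows "(bdiff ^^ t) c m = 0"
  using assms(2) by (induction t arbitrary: m) (simp_all add: assms(1) bdiff_def)

lemma bdiff_funpow_zero_above:
  assumes "\<And>m. m > M \<Longrightarrow> c m = 0" "m > M + int t"
  shows "(bdiff ^^ t) c m = 0"
  using assms(2) by (induction t arbitrary: m) (simp_all add: assms(1) bdiff_def)

context complex_vector_space
begin

lemma sum_by_parts:
  assumes "L \<le> U + 1"
  shows "(\<Sum>m=L..U. scale (\<beta> m) (bdiff c m)) =
    (\<Sum>m=L..U. scale (\<beta> (m + 1) - \<beta> m) (c m)) + scale (\<beta> L) (c (L - 1)) - scale (\<beta> (U + 1)) (c U)"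
proof -
  have "L - 1 \<le> U"
    using assms by simp
  then show ?thesis
  proof (induction U rule: int_ge_induct)
    case (step U)
    then have "{L..U + 1} = insert (U + 1) {L..U}"
      by auto
    then show ?case
      using step by (simp add: bdiff_def scale_left_diff_distrib scale_right_diff_distrib)
  qed simp
qed

text \<open>
  The difference operator is dual to the forward difference, which lowers \<open>m gchoose Suc t\<close> to \<open>m gchoose t\<close>. One
  application of it is therefore absorbed into the binomial coefficient when the boundary terms vanish.
\<close>

lemma sum_gchoose_bdiff:
  assumes "L \<le> U + 1"
    and "(of_int L gchoose Suc t :: complex) = 0 \<or> c (L - 1) = 0"
    and "(of_int (U + 1) gchoose Suc t :: complex) = 0 \<or> c U = 0"
  shows "(\<Sum>m=L..U. scale (of_int m gchoose Suc t) (bdiff c m)) = (\<Sum>m=L..U. scale (of_int m gchoose t) (c m))"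
proof -
  have "(of_int (m + 1) gchoose Suc t) - (of_int m gchoose Suc t) = (of_int m gchoose t :: complex)" for m
    using gbinomial_Suc_Suc[of "of_int m :: complex" t] by simp
  then show ?thesis
    using assms(2,3) by (auto simp: sum_by_parts[OF assms(1)] simp del: of_int_add)
qed

text \<open>
  In this lemma and the next one, all but one of the differences are absorbed: \<open>0 gchoose Suc t = 0\<close>
  removes the boundary term between the powers \<open>-1\<close> and \<open>0\<close>, and the support of \<open>c\<close> removes the other one. The last
  sum telescopes, and leaves the entry of \<open>c\<close> at \<open>-1\<close> with opposite signs on the two sides.
\<close>

lemma sum_gchoose_bdiff_negative:
  assumes "\<And>m. m < L \<Longrightarrow> c m = 0" "L \<le> 0"
  shows "(\<Sum>m=L..-1. scale (of_int m gchoose t) ((bdiff ^^ Suc t) c m)) = - c (- 1)"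
proof (induction t)
  case 0
  then show ?case
    using assms sum_by_parts[of L "- 1" "\<lambda>_. 1" c] by simp
next
  case (Suc t)
  have "(bdiff ^^ Suc t) c (L - 1) = 0"
    by (rule bdiff_funpow_zero_below) (use assms(1) in auto)
  then show ?case
    using Suc assms(2) sum_gchoose_bdiff[of L "- 1" t "(bdiff ^^ Suc t) c"] by simp
qed

lemma sum_gchoose_bdiff_nonneg:
  assumes "\<And>m. m > M \<Longrightarrow> c m = 0" "- 1 \<le> U" "M + int t < U"
  shows "(\<Sum>m=0..U. scale (of_int m gchoose t) ((bdiff ^^ Suc t) c m)) = c (- 1)"
  using assms(3)
proof (induction t)
  case 0
  then show ?case
    using assms sum_by_parts[of 0 U "\<lambda>_. 1" c] by simp
next
  case (Suc t)
  have "(bdiff ^^ Suc t) c U = 0"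
    by (rule bdiff_funpow_zero_above) (use assms(1) Suc.prems in auto)
  then show ?case
    using Suc assms(2) sum_gchoose_bdiff[of 0 U t "(bdiff ^^ Suc t) c"] by simp
qed

abbreviation x1_minus_x2 :: "complex poly poly" where
  "x1_minus_x2 \<equiv> x1_minus [:0, 1:]"

lemma polyact_x1_minus_x2_power:
  "polyact (x1_minus_x2 ^ t) C m (d + int t - m) w = (bdiff ^^ t) (\<lambda>m. C m (d - m) w) m"
proof (induction t arbitrary: m)
  case 0
  then show ?case
    by (simp add: mult_poly2_def)
next
  case (Suc t)
  show ?case
    unfolding bdiff_funpow_Suc Suc.IH[symmetric] power_Suc polyact_mult' polyact_x1_minus_x2
    by (simp add: algebra_simps)
qed

text \<open>
  A truncated \<open>F\<close> can be divided by \<open>(x\<^sub>1 - x\<^sub>2) ^ (i + 1)\<close> in two ways: \<open>C\<close> is truncated in \<open>x\<^sub>2\<close>, and \<open>D\<close> in \<open>x\<^sub>1\<close>.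
  The formal Cauchy formula states that the \<open>i\<close>-th Taylor coefficient of \<open>F\<close> along the diagonal is the difference
  of their residues. In the sum that defines the substitution, the negative powers of \<open>x\<^sub>1\<close> are written with \<open>C\<close>,
  which has no terms far below, and the nonnegative ones with \<open>D\<close>, which has no terms far above; neither
  can be used for the whole sum.
\<close>

lemma subst_nth_eq_residue_diff:
  assumes C: "\<And>m n. C m n w \<noteq> 0 \<Longrightarrow> n \<le> N" and D: "\<And>m n. D m n w \<noteq> 0 \<Longrightarrow> m \<le> M"
    and FC: "\<And>m n. F m n w = polyact (x1_minus_x2 ^ Suc i) C m n w"
    and FD: "\<And>m n. F m n w = polyact (x1_minus_x2 ^ Suc i) D m n w"
    and F: "bounded_at F w"
  shows "subst_x_plus_x0 scale F w $$ int i $$ l = D (- 1) (- l) w - C (- 1) (- l) w"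
proof -
  obtain M' N' where F: "\<And>m n. F m n w \<noteq> 0 \<Longrightarrow> m \<le> M' \<and> n \<le> N'"
    using F unfolding bounded_at_def by blast
  define L where "L = Min {0, - l - 1 - N, int i - l - N'}"
  define U where "U = Max {0, M', M + int i + 1}"
  \<comment> \<open>The coefficient at \<open>x ^ (- l)\<close> of the \<open>i\<close>-th Taylor coefficient involves the component of \<open>F\<close> of
      degree \<open>i - l\<close>, and hence those of \<open>C\<close> and \<open>D\<close> of degree \<open>- l - 1\<close>.\<close>
  let ?c = "\<lambda>m. C m (- l - 1 - m) w" and ?d = "\<lambda>m. D m (- l - 1 - m) w"
  have c: "F m (int i - m - l) w = (bdiff ^^ Suc i) ?c m" for m
    using polyact_x1_minus_x2_power[of "Suc i" C m "- l - 1" w]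
    by (simp add: FC algebra_simps del: power_Suc funpow.simps)
  have d: "F m (int i - m - l) w = (bdiff ^^ Suc i) ?d m" for m
    using polyact_x1_minus_x2_power[of "Suc i" D m "- l - 1" w]
    by (simp add: FD algebra_simps del: power_Suc funpow.simps)
  have "subst_x_plus_x0 scale F w $$ int i $$ l =
      (\<Sum>m=L..U. scale (of_int m gchoose i) (F m (int i - m - l) w))"
    by (rule subst_nth_interval[OF F]) (auto simp: L_def U_def)
  also have "{L..U} = {L..-1} \<union> {0..U}"
    by (auto simp: L_def U_def)
  also have "(\<Sum>m\<in>\<dots>. scale (of_int m gchoose i) (F m (int i - m - l) w)) =
      (\<Sum>m=L..-1. scale (of_int m gchoose i) ((bdiff ^^ Suc i) ?c m)) +
      (\<Sum>m=0..U. scale (of_int m gchoose i) ((bdiff ^^ Suc i) ?d m))"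
    by (subst sum.union_disjoint, simp_all only: finite_atLeastAtMost_int)
      (simp, rule arg_cong2[where f = "(+)"], simp only: c, simp only: d)
  also have "(\<Sum>m=L..-1. scale (of_int m gchoose i) ((bdiff ^^ Suc i) ?c m)) = - ?c (- 1)"
  proof (rule sum_gchoose_bdiff_negative)
    show "?c m = 0" if "m < L" for m
      using that C[of m "- l - 1 - m"] by (fastforce simp: L_def)
  qed (simp add: L_def)
  also have "(\<Sum>m=0..U. scale (of_int m gchoose i) ((bdiff ^^ Suc i) ?d m)) = ?d (- 1)"
  proof (rule sum_gchoose_bdiff_nonneg)
    show "?d m = 0" if "m > M" for m
      using that D[of m "- l - 1 - m"] by fastforce
  qed (simp_all add: U_def)
  finally show ?thesis
    by simp
qed

end

section \<open>The singular part of the products\<close>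

lemma emb_x_eq_0_iff: "emb_x q = 0 \<longleftrightarrow> q = 0"
  by (metis emb_x_hom(1) poly_eqI xcoeff_emb_x coeff_0)

lemma emb_x_x0_nth_neg: "n < 0 \<Longrightarrow> emb_x_x0 P $$ n = 0"
  by (induction P arbitrary: n) (simp_all add: emb_x_x0_hom emb_x_x0_pCons fls_X_times_conv_shift)

lemma emb_x_x0_monom_mult_nth: "emb_x_x0 ([:0, 1:] ^ t * P) $$ n = emb_x_x0 P $$ (n - int t)"
proof (induction t arbitrary: n)
  case (Suc t)
  have "[:0, 1:] ^ Suc t * P = pCons 0 ([:0, 1:] ^ t * P)"
    by simp
  then show ?case
    by (simp only: emb_x_x0_pCons) (simp add: Suc emb_x_hom fls_X_times_conv_shift(1) diff_diff_eq)
qed simp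

context complex_vector_space
begin

lemma polyact_nonzeroD:
  assumes "polyact p F m n w \<noteq> 0"
  obtains i j where "i \<le> degree p" "j \<le> (\<Sum>i\<le>degree p. degree (coeff p i))" "F (m - int i) (n - int j) w \<noteq> 0"
proof -
  obtain i where i: "i \<le> degree p"
    "(\<Sum>j\<le>degree (coeff p i). scale (coeff (coeff p i) j) (F (m - int i) (n - int j) w)) \<noteq> 0"
    using sum.not_neutral_contains_not_neutral[OF assms[unfolded mult_poly2_def]] by auto
  then obtain j where j: "j \<le> degree (coeff p i)" "F (m - int i) (n - int j) w \<noteq> 0"
    using sum.not_neutral_contains_not_neutral[OF i(2)] by auto
  moreover have "degree (coeff p i) \<le> (\<Sum>i\<le>degree p. degree (coeff p i))"
    using i(1) by (intro member_le_sum) auto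
  ultimately show ?thesis
    using that[OF i(1) _ j(2)] by linarith
qed

lemma polyact_bounded_x1:
  assumes "\<And>m n. F m n w \<noteq> 0 \<Longrightarrow> m \<le> M"
  shows "\<exists>M'. \<forall>m n. polyact p F m n w \<noteq> 0 \<longrightarrow> m \<le> M'"
proof (intro exI[of _ "M + int (degree p)"] allI impI)
  fix m n
  assume "polyact p F m n w \<noteq> 0"
  then obtain i j where "i \<le> degree p" "j \<le> (\<Sum>i\<le>degree p. degree (coeff p i))"
    "F (m - int i) (n - int j) w \<noteq> 0"
    by (rule polyact_nonzeroD)
  then show "m \<le> M + int (degree p)"
    using assms[of "m - int i" "n - int j"] by linarith
qed

lemma polyact_bounded_x2:
  assumes "\<And>m n. F m n w \<noteq> 0 \<Longrightarrow> n \<le> N"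
  shows "\<exists>N'. \<forall>m n. polyact p F m n w \<noteq> 0 \<longrightarrow> n \<le> N'"
proof (intro exI[of _ "N + int (\<Sum>i\<le>degree p. degree (coeff p i))"] allI impI)
  fix m n
  assume "polyact p F m n w \<noteq> 0"
  then obtain i j where "i \<le> degree p" "j \<le> (\<Sum>i\<le>degree p. degree (coeff p i))"
    "F (m - int i) (n - int j) w \<noteq> 0"
    by (rule polyact_nonzeroD)
  then show "n \<le> N + int (\<Sum>i\<le>degree p. degree (coeff p i))"
    using assms[of "m - int i" "n - int j"] by linarith
qed

lemma op_prod_bounded_x2:
  assumes "a \<in> Eo scale" "op_prod a b m n w \<noteq> 0"
  shows "n \<le> - fls_subdegree (b w)"
proof -
  have "a (0 + 0) = a 0 + a 0"
    using assms(1) by (simp only: Eo_def mem_Collect_eq Vector_Spaces.linear_iff)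
  then have "a 0 = 0"
    by simp
  then have "xcoeff (b w) n \<noteq> 0"
    using assms(2) by (auto simp: op_prod_def xcoeff_def)
  then show ?thesis
    using fls_subdegree_leI[of "b w" "- n"] by (simp add: xcoeff_def)
qed

lemma linear_op_prod:
  assumes "a \<in> Eo scale" "b \<in> Eo scale"
  shows "Vector_Spaces.linear scale scale (op_prod a b m n)"
proof -
  have "Vector_Spaces.linear scale scale ((\<lambda>w. xcoeff (a w) m) \<circ> (\<lambda>w. xcoeff (b w) n))"
    using assms Eo_iff[OF vector_space_axioms] by (intro Vector_Spaces.linear_compose) auto
  then show ?thesis
    by (simp add: op_prod_def[abs_def] o_def)
qed

text \<open>
  Dividing by \<open>P\<close> lowers the order in \<open>x\<^sub>0\<close> by that of \<open>P\<close>, since the coefficients of \<open>P\<close> lie in a field.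
\<close>

lemma fls2_act_regular:
  fixes P :: "complex fls fls" and R :: "'w fls fls"
  assumes "P \<noteq> 0" "\<And>n. n < fls_subdegree P \<Longrightarrow> fls_act (fls_act scale) P R $$ n = 0" "n < 0"
  shows "R $$ n = 0"
proof -
  let ?V = "fls_act (fls_act scale) P R"
  have "R = fls_act (fls_act scale) (inverse P) ?V"
    using assms(1) by (simp add: fls2.scale_scale)
  also have "\<dots> $$ n = (\<Sum>i\<in>{- fls_subdegree P..- fls_subdegree P - 1}. fls_act scale (inverse P $$ i) (?V $$ (n - i)))"
    using assms by (intro fls.fls_act_nth_eq_sum_interval[where q = "fls_subdegree P"]) auto
  finally show ?thesis
    by simp
qed

text \<open>
  Both sides become equal after multiplication by \<open>p(x + x\<^sub>0, x)\<close>, since \<open>p\<close> and \<open>q\<close> commute. This contains the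
  independence of the choice of \<open>p\<close>: any admissible \<open>q\<close> determines the series computed with \<open>p\<close>.
\<close>

lemma Y_Eo_with_cross_mult:
  assumes p: "admissible scale a b p" and q: "admissible scale a b q"
  shows "fls_act (fls_act scale) (emb_x_x0 (expand_x1 q)) (Y_Eo_with scale p a b w) =
    subst_x_plus_x0 scale (polyact q (op_prod a b)) w"
proof -
  let ?act = "fls_act (fls_act scale)" and ?T = "\<lambda>F. subst_x_plus_x0 scale F w"
  let ?P = "emb_x_x0 (expand_x1 p)" and ?Q = "emb_x_x0 (expand_x1 q)"
  have "expand_x1 p \<noteq> 0"
    using p by (auto simp: admissible_def pcompose_eq_0_iff)
  then have P: "?P \<noteq> 0" and "iota (Fract 1 (expand_x1 p)) = 1 / ?P"
    by (simp_all add: emb_x_x0_eq_0_iff iota_Fract emb_x_x0_hom)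
  then have Y: "Y_Eo_with scale p a b w = ?act (1 / ?P) (?T (polyact p (op_prod a b)))"
    by (simp add: Y_Eo_with_def)
  have bd: "bounded_at (polyact p (op_prod a b)) w" "bounded_at (polyact q (op_prod a b)) w"
    using p q by (auto simp: admissible_def Hom_trunc2_def bounded_at_def)
  have "?act ?Q (?T (polyact p (op_prod a b))) = ?T (polyact q (polyact p (op_prod a b)))"
    using bd by (simp add: subst_polyact)
  also have "\<dots> = ?T (polyact p (polyact q (op_prod a b)))"
    by (simp only: polyact_mult'[symmetric] mult.commute)
  also have "\<dots> = ?act ?P (?T (polyact q (op_prod a b)))"
    using bd by (simp add: subst_polyact)
  finally have "?act (1 / ?P) (?act ?Q (?T (polyact p (op_prod a b)))) =
      ?act (1 / ?P) (?act ?P (?T (polyact q (op_prod a b))))"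
    by simp
  then show ?thesis
    using P by (simp add: Y fls2.scale_scale mult.commute)
qed

end

locale affine_commutator = complex_vector_space scale
  for scale :: "complex \<Rightarrow> 'w::ab_group_add \<Rightarrow> 'w" +
  fixes a b :: "'w \<Rightarrow> 'w fls"
    and A :: "nat \<Rightarrow> 'w \<Rightarrow> 'w fls"
    and B :: "nat \<Rightarrow> nat \<Rightarrow> 'w \<Rightarrow> 'w fls"
    and g :: "nat \<Rightarrow> complex poly"
    and r k s :: nat
  assumes a: "a \<in> Eo scale" and b: "b \<in> Eo scale"
    and g: "\<And>i. 1 \<le> i \<Longrightarrow> i \<le> k \<Longrightarrow> g i \<in> affine_G \<and> g i \<noteq> [:0, 1:]"
    and comm: "\<And>m n w. commutator a b m n w =
           (\<Sum>j=0..r. delta_term j [:0, 1:] (A j) m n w) +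
           (\<Sum>i=1..k. \<Sum>j=0..s. delta_term j (g i) (B i j) m n w)"
begin

text \<open>
  The polynomial \<open>q\<close>, which removes the delta functions supported away from the diagonal \<open>x\<^sub>1 = x\<^sub>2\<close>.
\<close>

definition off_diagonal :: "complex poly poly" where
  "off_diagonal = (\<Prod>i=1..k. x1_minus (g i) ^ Suc s)"

definition annihilator :: "nat \<Rightarrow> complex poly poly" where
  "annihilator t = x1_minus_x2 ^ t * off_diagonal"

abbreviation opposite_prod where
  "opposite_prod \<equiv> \<lambda>m n w. op_prod b a n m w"

lemma polyact_off_diagonal:
  assumes "i \<in> {1..k}" "j \<le> s"
  shows "polyact off_diagonal (delta_term j (g i) v) = (\<lambda>m n w. 0)"
proof -
  have "off_diagonal = (\<Prod>i\<in>{1..k} - {i}. x1_minus (g i) ^ Suc s) * x1_minus (g i) ^ Suc s"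
    using assms(1) by (simp add: off_diagonal_def prod.remove mult.commute del: power_Suc)
  moreover have "polyact (x1_minus (g i) ^ Suc s) (delta_term j (g i) v) = (\<lambda>m n w. 0)"
    using assms g by (intro polyact_x1_minus_power_delta_term) auto
  ultimately show ?thesis
    by (simp add: polyact_mult' del: power_Suc)
qed

lemma polyact_annihilator_commutator:
  "polyact (annihilator t) (commutator a b) m n w =
    (\<Sum>j=0..r. polyact (annihilator t) (delta_term j [:0, 1:] (A j)) m n w)"
proof -
  have "polyact (annihilator t) (delta_term j (g i) (B i j)) = (\<lambda>m n w. 0)" if "i \<in> {1..k}" "j \<in> {0..s}" for i j
    using that by (simp add: annihilator_def polyact_mult' polyact_off_diagonal)
  then show ?thesis
    by (simp add: comm[abs_def] polyact_add_right polyact_sum_right)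
qed

lemma polyact_annihilator_commutator_eq_diff:
  "polyact (annihilator t) (commutator a b) m n w =
    polyact (annihilator t) (op_prod a b) m n w - polyact (annihilator t) opposite_prod m n w"
  by (simp add: commutator_def[abs_def] polyact_diff_right)

text \<open>
  The power \<open>r + 1\<close> of \<open>x\<^sub>1 - x\<^sub>2\<close> also removes the derivatives of order at most \<open>r\<close> of the delta function on the diagonal.
\<close>

lemma polyact_annihilator_comm:
  "polyact (annihilator (Suc r)) (op_prod a b) = polyact (annihilator (Suc r)) opposite_prod"
proof (intro ext)
  fix m n w
  have "polyact (annihilator (Suc r)) (delta_term j [:0, 1:] (A j)) m n w = 0" if "j \<le> r" for j
  proof -
    have "polyact (x1_minus_x2 ^ Suc r) (delta_term j [:0, 1:] (A j)) = (\<lambda>m n w. 0)"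
      using that by (intro polyact_x1_minus_power_delta_term) (auto simp: affine_G_def)
    then show ?thesis
      by (simp only: annihilator_def mult.commute[of _ off_diagonal] polyact_mult' polyact_0_right)
  qed
  then show "polyact (annihilator (Suc r)) (op_prod a b) m n w = polyact (annihilator (Suc r)) opposite_prod m n w"
    using polyact_annihilator_commutator[of "Suc r" m n w]
      polyact_annihilator_commutator_eq_diff[of "Suc r" m n w] by simp
qed

text \<open>
  The product \<open>a(x\<^sub>1) b(x\<^sub>2) w\<close> is truncated in \<open>x\<^sub>2\<close> and \<open>b(x\<^sub>2) a(x\<^sub>1) w\<close> in \<open>x\<^sub>1\<close>. The multiples of both by the annihilator
  are the same series, which inherits both bounds.
\<close>

lemma bounded_at_polyact_annihilator: "bounded_at (polyact (annihilator (Suc r)) (op_prod a b)) w"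
proof -
  obtain N where "\<And>m n. polyact (annihilator (Suc r)) (op_prod a b) m n w \<noteq> 0 \<Longrightarrow> n \<le> N"
    using polyact_bounded_x2[of "op_prod a b" w "- fls_subdegree (b w)"] op_prod_bounded_x2[OF a]
    by blast
  moreover obtain M where "\<And>m n. polyact (annihilator (Suc r)) opposite_prod m n w \<noteq> 0 \<Longrightarrow> m \<le> M"
    using polyact_bounded_x1[of opposite_prod w "- fls_subdegree (a w)"] op_prod_bounded_x2[OF b]
    by blast
  ultimately show ?thesis
    by (intro bounded_atI[where M = M and N = N]) (simp add: polyact_annihilator_comm)
qed

text \<open>
  The value \<open>q(x, x)\<close> is the product of the \<open>(x - g\<^sub>i(x)) ^ (s + 1)\<close>. This is where \<open>g\<^sub>i \<noteq> x\<close> is used.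
\<close>

lemma poly_off_diagonal_ne_0: "poly off_diagonal [:0, 1:] \<noteq> 0"
proof -
  have "poly (x1_minus (g i)) [:0, 1:] \<noteq> 0" if "i \<in> {1..k}" for i
    using g[of i] that by (simp add: eq_commute[of "[:0, 1:]"])
  then show ?thesis
    by (simp add: off_diagonal_def poly_prod poly_power del: power_Suc poly_pCons)
qed

lemma admissible_annihilator: "admissible scale a b (annihilator (Suc r))"
proof -
  have "off_diagonal \<noteq> 0"
    using poly_off_diagonal_ne_0 by auto
  then have "annihilator (Suc r) \<noteq> 0"
    by (simp add: annihilator_def del: power_Suc)
  then show ?thesis
    using bounded_at_polyact_annihilator linear_polyact[OF linear_op_prod[OF a b]]
    by (simp add: admissible_def Hom_trunc2_def bounded_at_def)
qed

text \<open>
  The series \<open>q(x + x\<^sub>0, x)\<close>; its coefficients vanish at negative indices, so that sums with \<open>h $$ n\<close> need no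
  restriction on \<open>n\<close>.
\<close>

abbreviation h :: "complex fls fls" where
  "h \<equiv> emb_x_x0 (expand_x1 off_diagonal)"

lemma emb_x_x0_annihilator_nth: "emb_x_x0 (expand_x1 (annihilator t)) $$ n = h $$ (n - int t)"
proof -
  have "expand_x1 (annihilator t) = [:0, 1:] ^ t * expand_x1 off_diagonal"
  proof -
    have "expand_x1 (x1_minus_x2 ^ t) = [:0, 1:] ^ t"
      by (induction t) (simp_all only: power_0 power_Suc pcompose_1 pcompose_mult, simp add: pcompose_pCons)
    then show ?thesis
      by (simp only: annihilator_def pcompose_mult)
  qed
  then show ?thesis
    by (simp add: emb_x_x0_monom_mult_nth)
qed

text \<open>
  Splitting off \<open>(x\<^sub>1 - x\<^sub>2) ^ (i + 1)\<close> from the annihilator leaves \<open>(x\<^sub>1 - x\<^sub>2) ^ (r - i) q\<close>, whose products with the two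
  orderings are the quotients \<open>C\<close> and \<open>D\<close> in the residue formula. Their difference is a multiple of the commutator.
\<close>

lemma subst_annihilator_nth:
  assumes "i \<le> r"
  shows "subst_x_plus_x0 scale (polyact (annihilator (Suc r)) (op_prod a b)) w $$ int i =
    - (\<Sum>j=0..r. fls_act scale (h $$ (int i + int j - int r)) (A j w))"
proof (rule fls_eqI)
  fix l
  let ?C = "polyact (annihilator (r - i)) (op_prod a b)" and ?D = "polyact (annihilator (r - i)) opposite_prod"
  have split: "annihilator (Suc r) = x1_minus_x2 ^ Suc i * annihilator (r - i)"
    using assms by (simp add: annihilator_def mult.assoc[symmetric] flip: power_add del: power_Suc)
  obtain N where N: "\<And>m n. ?C m n w \<noteq> 0 \<Longrightarrow> n \<le> N"
    using polyact_bounded_x2[of "op_prod a b" w "- fls_subdegree (b w)"] op_prod_bounded_x2[OF a]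
    by blast
  obtain M where M: "\<And>m n. ?D m n w \<noteq> 0 \<Longrightarrow> m \<le> M"
    using polyact_bounded_x1[of opposite_prod w "- fls_subdegree (a w)"] op_prod_bounded_x2[OF b]
    by blast
  have "subst_x_plus_x0 scale (polyact (annihilator (Suc r)) (op_prod a b)) w $$ int i $$ l =
      ?D (- 1) (- l) w - ?C (- 1) (- l) w"
  proof (rule subst_nth_eq_residue_diff)
    show "n \<le> N" if "?C m n w \<noteq> 0" for m n
      using that by (rule N)
    show "m \<le> M" if "?D m n w \<noteq> 0" for m n
      using that by (rule M)
    show "polyact (annihilator (Suc r)) (op_prod a b) m n w = polyact (x1_minus_x2 ^ Suc i) ?C m n w" for m n
      by (simp only: split polyact_mult')
    show "polyact (annihilator (Suc r)) (op_prod a b) m n w = polyact (x1_minus_x2 ^ Suc i) ?D m n w" for m n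
      unfolding polyact_annihilator_comm by (simp only: split polyact_mult')
  qed (rule bounded_at_polyact_annihilator)
  also have "\<dots> = - polyact (annihilator (r - i)) (commutator a b) (- 1) (- l) w"
    by (simp add: polyact_annihilator_commutator_eq_diff)
  also have "\<dots> = - (\<Sum>j=0..r. fls_act scale (h $$ (int i + int j - int r)) (A j w)) $$ l"
  proof -
    have "emb_x (coeff (expand_x1 (annihilator (r - i))) j) = h $$ (int i + int j - int r)" for j
      using assms by (simp add: emb_x_x0_nth[symmetric] emb_x_x0_annihilator_nth of_nat_diff algebra_simps)
    then show ?thesis
      unfolding polyact_annihilator_commutator polyact_delta_term_residue
      by (simp add: xcoeff_def fls_nth_sum)
  qed
  finally show "subst_x_plus_x0 scale (polyact (annihilator (Suc r)) (op_prod a b)) w $$ int i $$ l =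
    (- (\<Sum>j=0..r. fls_act scale (h $$ (int i + int j - int r)) (A j w))) $$ l"
    by simp
qed

text \<open>
  The series \<open>(\<Sum>j\<le>r. A\<^sub>j(x) x\<^sub>0 ^ (- j - 1))\<close>
\<close>

definition singular_part :: "'w \<Rightarrow> 'w fls fls" where
  "singular_part w = Abs_fls (\<lambda>n. if - int r - 1 \<le> n \<and> n < 0 then A (nat (- n - 1)) w else 0)"

lemma singular_part_nth:
  "singular_part w $$ n = (if - int r - 1 \<le> n \<and> n < 0 then A (nat (- n - 1)) w else 0)"
  unfolding singular_part_def by (rule nth_Abs_fls_lower_bound[of "- int r - 1"]) auto

text \<open>
  For \<open>0 \<le> n \<le> r\<close> this is the negative of \<open>subst_annihilator_nth\<close>, and it vanishes for \<open>n < 0\<close>.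
\<close>

lemma annihilator_singular_part_nth:
  "fls_act (fls_act scale) (emb_x_x0 (expand_x1 (annihilator (Suc r)))) (singular_part w) $$ n =
    (\<Sum>j=0..r. fls_act scale (h $$ (n + int j - int r)) (A j w))"
proof -
  let ?P = "emb_x_x0 (expand_x1 (annihilator (Suc r)))"
  let ?f = "\<lambda>j. n + 1 + int j"
  have "fls_act (fls_act scale) ?P (singular_part w) $$ n =
      (\<Sum>i\<in>?f ` {0..r}. fls_act scale (?P $$ i) (singular_part w $$ (n - i)))"
  proof (rule fls.fls_act_nth_eq_sum)
    fix i assume "singular_part w $$ (n - i) \<noteq> 0"
    then have "- int r - 1 \<le> n - i" "n - i < 0"
      by (auto simp: singular_part_nth split: if_splits)
    then show "i \<in> ?f ` {0..r}"
      by (intro image_eqI[of _ _ "nat (i - n - 1)"]) auto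
  qed simp
  also have "\<dots> = (\<Sum>j=0..r. fls_act scale (?P $$ ?f j) (singular_part w $$ (n - ?f j)))"
    by (subst sum.reindex) (auto simp: inj_on_def)
  also have "\<dots> = (\<Sum>j=0..r. fls_act scale (h $$ (n + int j - int r)) (A j w))"
    by (intro sum.cong refl) (simp add: emb_x_x0_annihilator_nth singular_part_nth algebra_simps)
  finally show ?thesis .
qed

text \<open>
  Multiplied by the annihilator, whose order in \<open>x\<^sub>0\<close> is \<open>r + 1\<close>, the sum of \<open>Y\<close> and the expected singular part has
  order at least \<open>r + 1\<close>. Hence the sum has no negative powers of \<open>x\<^sub>0\<close>.
\<close>

lemma Y_Eo_with_nth_neg:
  assumes "admissible scale a b p" "n < 0"
  shows "Y_Eo_with scale p a b w $$ n = - singular_part w $$ n"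
proof -
  let ?P = "emb_x_x0 (expand_x1 (annihilator (Suc r)))"
  let ?R = "Y_Eo_with scale p a b w + singular_part w"
  have "h $$ 0 \<noteq> 0"
    using poly_off_diagonal_ne_0 emb_x_x0_nth[of "expand_x1 off_diagonal" 0]
    by (simp add: pcompose_coeff_0 emb_x_eq_0_iff)
  then have P: "fls_subdegree ?P = int (Suc r)" "?P \<noteq> 0"
    by (auto intro!: fls_subdegree_eqI simp: emb_x_x0_annihilator_nth emb_x_x0_nth_neg)
       (metis cancel_comm_monoid_add_class.diff_cancel emb_x_x0_annihilator_nth fls_zero_nth)
  have "?R $$ n = 0"
  proof (rule fls2_act_regular[OF P(2) _ assms(2)])
    fix i assume "i < fls_subdegree ?P"
    then have i: "i \<le> int r"
      by (simp add: P)
    have "fls_act (fls_act scale) ?P ?R $$ i =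
        subst_x_plus_x0 scale (polyact (annihilator (Suc r)) (op_prod a b)) w $$ i +
        (\<Sum>j=0..r. fls_act scale (h $$ (i + int j - int r)) (A j w))"
      by (simp add: fls2.scale_right_distrib Y_Eo_with_cross_mult[OF assms(1) admissible_annihilator]
          annihilator_singular_part_nth)
    also have "\<dots> = 0"
    proof (cases "i < 0")
      case True
      then show ?thesis
        by (auto simp: subst_nth_neg emb_x_x0_nth_neg intro!: sum.neutral)
    next
      case False
      then show ?thesis
        using i subst_annihilator_nth[of "nat i" w] by simp
    qed
    finally show "fls_act (fls_act scale) ?P ?R $$ i = 0" .
  qed
  then show ?thesis
    by (simp add: eq_neg_iff_add_eq_0)
qed

end

theorem lemma2p8:
  fixes scale :: "complex \<Rightarrow> 'w::ab_group_add \<Rightarrow> 'w"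
    and a b :: "'w \<Rightarrow> 'w fls"
    and A :: "nat \<Rightarrow> 'w \<Rightarrow> 'w fls"
    and B :: "nat \<Rightarrow> nat \<Rightarrow> 'w \<Rightarrow> 'w fls"
    and g :: "nat \<Rightarrow> complex poly"
    and r k s :: nat
  assumes "vector_space scale"
    and "a \<in> Eo scale" and "b \<in> Eo scale"
    and "\<And>j. j \<le> r \<Longrightarrow> A j \<in> Eo scale"
    and "\<And>i j. 1 \<le> i \<Longrightarrow> i \<le> k \<Longrightarrow> j \<le> s \<Longrightarrow> B i j \<in> Eo scale"
    and "\<And>i. 1 \<le> i \<Longrightarrow> i \<le> k \<Longrightarrow> g i \<in> affine_G \<and> g i \<noteq> [:0, 1:]"
    and "\<And>m n w. commutator a b m n w =
           (\<Sum>j=0..r. xcoeff (fls_act scale (delta_deriv j [:0, 1:] m) (A j w)) n) +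
           (\<Sum>i=1..k. \<Sum>j=0..s. xcoeff (fls_act scale (delta_deriv j (g i) m) (B i j w)) n)"
  shows "(\<exists>p. admissible scale a b p) \<and>
         (\<forall>j\<le>r. nth_prod scale a (int j) b = (\<lambda>w. - A j w)) \<and>
         (\<forall>j>r. nth_prod scale a (int j) b = (\<lambda>w. 0))"
proof -
  interpret vector_space scale
    by fact
  interpret affine_commutator scale a b A B g r k s
    by unfold_locales (use assms in auto)
  have "\<exists>p. admissible scale a b p"
    using admissible_annihilator by blast
  then have "admissible scale a b (SOME p. admissible scale a b p)"
    by (rule someI_ex)
  then have "nth_prod scale a (int j) b = (\<lambda>w. - singular_part w $$ (- int j - 1))" for j
    by (auto simp: nth_prod_def Y_Eo_with_nth_neg)
  then show ?thesis
    using admissible_annihilator by (auto simp: singular_part_nth)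
qed

end
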